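(* Let $p\equiv 1\pmod 4$ be prime and let $T^{4,4,1}$ be the matrix with rows and columns indexed by $\binom{\mathbb{F}_p}{2}$ whose entry at $(\{a,b\},\{c,d\})$ equals $\chi(a-c)\chi(a-d)\chi(b-c)\chi(b-d)$ if $\{a,b\}\cap\{c,d\}=\emptyset$ and $0$ otherwise. Then $\|T^{4,4,1}\| = O(p^{5/4})$ as $p\to\infty$.
   Context: $\chi$ denotes the Legendre symbol of $\mathbb{F}_p$ ($\chi(0)=0$, $\chi(x)=1$ for nonzero squares, $-1$ for non-squares). $\binom{\mathbb{F}_p}{2}$ is the set of 2-element subsets of $\mathbb{F}_p$. $\|\cdot\|$ is the operator (spectral) norm. *)

theory Defs
  imports "HOL-Analysis.Analysis" "HOL-Number_Theory.Number_Theory"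
    "HOL-Library.Landau_Symbols"
begin

text \<open>
  The field \<open>\<F>\<^sub>p\<close> is represented by the integer residues \<open>{0..<p}\<close>; the library's
  Legendre symbol depends only on its first argument modulo \<open>p\<close>, so differences may be
  formed in the integers.
\<close>

definition pairs_mod :: "nat \<Rightarrow> int set set" where
  "pairs_mod p = {S. S \<subseteq> {0..<int p} \<and> card S = 2}"

text \<open>For \<open>S = {a, b}\<close> and \<open>U = {c, d}\<close> the product runs over the four pairs
  \<open>(a, c)\<close>, \<open>(a, d)\<close>, \<open>(b, c)\<close>, \<open>(b, d)\<close>.\<close>

definition T441 :: "nat \<Rightarrow> int set \<Rightarrow> int set \<Rightarrow> real" where
  "T441 p S U =
    (if S \<inter> U = {} then \<Prod>x\<in>S. \<Prod>y\<in>U. real_of_int (Legendre (x - y) (int p)) else 0)"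

text \<open>
  The \<open>\<ell>\<^sup>2\<close> operator norm of a real matrix with rows and columns indexed by a finite set
  \<open>I\<close>. It follows the library's \<^const>\<open>onorm\<close>, which is not directly applicable since the
  index set varies with \<open>p\<close>; vectors with \<open>L2_set x I = 0\<close> contribute \<open>0\<close>.
\<close>

definition matrix_opnorm :: "'i set \<Rightarrow> ('i \<Rightarrow> 'i \<Rightarrow> real) \<Rightarrow> real" where
  "matrix_opnorm I A =
    (SUP x. L2_set (\<lambda>i. \<Sum>j\<in>I. A i j * x j) I / L2_set x I)"

lemma T441_doubleton:
  assumes "a \<noteq> b" "c \<noteq> d" "{a, b} \<inter> {c, d} = {}"
  shows "T441 p {a, b} {c, d} = real_of_int
    (Legendre (a - c) (int p) * Legendre (a - d) (int p) *
     Legendre (b - c) (int p) * Legendre (b - d) (int p))"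
  using assms by (simp add: T441_def)

text \<open>The supremum is taken over a bounded set, so it is a genuine one.\<close>

lemma bdd_above_matrix_opnorm:
  fixes A :: "'i \<Rightarrow> 'i \<Rightarrow> real"
  assumes "finite I"
  shows "bdd_above (range (\<lambda>x. L2_set (\<lambda>i. \<Sum>j\<in>I. A i j * x j) I / L2_set x I))"
proof (rule bdd_aboveI2)
  fix x :: "'i \<Rightarrow> real"
  have "\<bar>\<Sum>j\<in>I. A i j * x j\<bar> \<le> L2_set (A i) I * L2_set x I" for i
  proof -
    have "\<bar>\<Sum>j\<in>I. A i j * x j\<bar> \<le> (\<Sum>j\<in>I. \<bar>A i j\<bar> * \<bar>x j\<bar>)"
      by (rule order_trans[OF sum_abs]) (simp add: abs_mult)
    also have "\<dots> \<le> L2_set (A i) I * L2_set x I"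
      by (rule L2_set_mult_ineq)
    finally show ?thesis .
  qed
  then have "(\<Sum>i\<in>I. \<bar>\<Sum>j\<in>I. A i j * x j\<bar>) \<le> (\<Sum>i\<in>I. L2_set (A i) I) * L2_set x I"
    by (simp add: sum_distrib_right sum_mono)
  with L2_set_le_sum_abs
  have "L2_set (\<lambda>i. \<Sum>j\<in>I. A i j * x j) I \<le> (\<Sum>i\<in>I. L2_set (A i) I) * L2_set x I"
    by (rule order_trans)
  then show "L2_set (\<lambda>i. \<Sum>j\<in>I. A i j * x j) I / L2_set x I \<le> (\<Sum>i\<in>I. L2_set (A i) I)"
    by (cases "L2_set x I = 0")
      (simp_all add: sum_nonneg L2_set_nonneg divide_le_eq order_less_le)
qed

end

theory Submission
  imports Defs "HOL-Computational_Algebra.Polynomial" "HOL-Library.Real_Mod"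
begin

text \<open>
  The entry of the matrix at \<open>({a, b}, {c, d})\<close> is \<open>\<chi>\<close> of the cross-ratio of the four points, so the
  matrix extends to pairs of points of the projective line, and the extension \<open>T\<close> commutes with
  \<open>PGL\<^sub>2(\<F>\<^sub>p)\<close>. Off the diagonal the entries of \<open>T\<^sup>2\<close> are \<open>s\<^sup>2 - O(p)\<close> with a sum \<open>s\<close> of \<open>\<chi>\<close> over a
  quartic, which a Moebius transformation turns into a cubic; Stepanov's method gives
  \<open>s\<^sup>2 = O(p)\<close>, hence \<open>tr T\<^sup>4 = O(p\<^sup>6)\<close>. A nonconstant eigenfunction generates a representation of
  dimension at least \<open>p - 1\<close>, so a nontrivial eigenvalue \<open>\<lambda>\<close> satisfies \<open>(p - 1) \<lambda>\<^sup>4 \<le> tr T\<^sup>4\<close>,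
  that is \<open>\<lambda> = O(p\<^bsup>5/4\<^esup>)\<close>; on constants \<open>T\<close> is the scalar \<open>-(p - 1)\<close> (for ordered pairs).

  No eigenvectors are needed. Functions whose average over translations vanishes split under the
  characters of the translation group, which the dilations permute transitively, and Bessel's
  inequality replaces the count of multiplicities. A translation invariant function is first
  moved by the inversion.
\<close>

text \<open>The entries of \<open>T\<close> have absolute value at most 1 and show no cancellation:
  the multiplicity p - 1 against the Frobenius norm of \<open>T\<close> itself gives only \<lambda>
  = O(p^(3/2)). Squaring brings in the correlation of two rows, where square-root cancellation cuts
  an entry from order p^2 to O(p). In the Frobenius norm of T^2 the roughly p^4 generic entries and
  the roughly p^2 entries at equal or swapped pairs, of size p^2 each, then both contribute order
  p^6; so this argument gains no more than a constant from sharper character sums. The point at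
  infinity is what lets the inversion act: translations and dilations alone leave all functions of a
  - b out of reach of the multiplicity argument. Constants are fixed by the whole group and have to
  be split off by hand. The congruence of p modulo 4 gives chi(-1) = 1, so that differences may be
  taken in either order.\<close>

hide_const (open) Module.smult UnivPoly.monom UnivPoly.coeff

section \<open>Polynomials modulo a prime\<close>

lemma residue_dvd_diff_iff:
  fixes s t m :: int
  assumes "s \<in> {0..<m}" "t \<in> {0..<m}"
  shows "m dvd s - t \<longleftrightarrow> s = t"
proof -
  have "m dvd s - t \<longleftrightarrow> s mod m = t mod m" by (rule mod_eq_dvd_iff[symmetric])
  also have "\<dots> \<longleftrightarrow> s = t" using assms by simp
  finally show ?thesis .
qed

section \<open>Higher derivatives and multiple roots modulo p\<close>

lemma higher_pderiv_const_mult: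
  fixes P :: "int poly"
  shows "(pderiv ^^ k) ([:c:] * P) = [:c:] * (pderiv ^^ k) P"
  by (induction k) (simp_all add: pderiv_smult)

lemma higher_pderiv_diff_int:
  fixes P Q :: "int poly"
  shows "(pderiv ^^ k) (P - Q) = (pderiv ^^ k) P - (pderiv ^^ k) Q"
  by (induction k) (simp_all add: pderiv_diff)

lemma higher_pderiv_sum_smult:
  fixes P :: "'a \<Rightarrow> int poly"
  shows "(pderiv ^^ k) (\<Sum>u\<in>U. smult (c u) (P u)) = (\<Sum>u\<in>U. smult (c u) ((pderiv ^^ k) (P u)))"
proof (induction k)
  case (Suc k)
  have "pderiv (\<Sum>u\<in>U. Q u) = (\<Sum>u\<in>U. pderiv (Q u))" for Q :: "'a \<Rightarrow> int poly"
    by (rule poly_eqI) (simp add: coeff_pderiv coeff_sum sum_distrib_left)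
  with Suc show ?case
    by (simp add: pderiv_smult)
qed simp

text \<open>One derivative turns (x - a)^(j+1) Q into (x - a)^j times the cofactor (j+1) Q + (x - a)
  Q', whose value at a is (j+1) Q(a); iterating collects the factorial. The identity holds over the
  integers, so reduction modulo p can wait.\<close>

lemma higher_pderiv_root_power:
  fixes Q :: "int poly"
  shows "poly ((pderiv ^^ j) ([:-a, 1:] ^ j * Q)) a = fact j * poly Q a"
proof (induction j arbitrary: Q)
  case (Suc j)
  have "pderiv ([:-a, 1:] ^ Suc j * Q) =
      [:-a, 1:] ^ j * (smult (of_nat (Suc j)) Q + [:-a, 1:] * pderiv Q)"
    by (simp only: pderiv_mult pderiv_power_Suc)
       (simp add: pderiv_pCons algebra_simps)
  then have "(pderiv ^^ Suc j) ([:-a, 1:] ^ Suc j * Q) =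
      (pderiv ^^ j) ([:-a, 1:] ^ j * (smult (of_nat (Suc j)) Q + [:-a, 1:] * pderiv Q))"
    by (simp only: funpow_Suc_right o_apply)
  then show ?case
    using Suc[of "smult (of_nat (Suc j)) Q + [:-a, 1:] * pderiv Q"] by (simp add: algebra_simps)
qed simp

lemma const_dvd_polyD:
  fixes P :: "int poly"
  assumes "[:c:] dvd P"
  shows "c dvd poly P a"
  using assms by (auto elim!: dvdE)

lemma root_mod_factor:
  fixes Q :: "int poly"
  assumes "c dvd poly Q a"
  shows "\<exists>Q'. [:c:] dvd Q - [:-a, 1:] * Q'"
proof -
  have "Q - [:-a, 1:] * synthetic_div Q a = [:poly Q a:]"
    using synthetic_div_correct'[of a Q] by (metis add_diff_cancel_left')
  then show ?thesis
    using assms by (metis const_poly_dvd_const_poly_iff)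
qed

text \<open>Congruence modulo p of integer polynomials is written as divisibility by
  \<open>[:int p:]\<close>. Once (x - a)^l is split off, the l-th derivative at a is l! times the
  value of the cofactor, and l! is invertible modulo p for l < p; so the cofactor vanishes at a and
  yields the next factor.\<close>

lemma multiple_root_mod:
  fixes R :: "int poly" and p :: nat
  assumes "prime p" "l \<le> p" "\<And>k. k < l \<Longrightarrow> int p dvd poly ((pderiv ^^ k) R) a"
  shows "\<exists>Q. [:int p:] dvd R - [:-a, 1:] ^ l * Q"
  using assms(2,3)
proof (induction l)
  case (Suc l)
  then obtain Q where Q: "[:int p:] dvd R - [:-a, 1:] ^ l * Q"
    by force
  then obtain E where E: "R - [:-a, 1:] ^ l * Q = [:int p:] * E" by (elim dvdE)
  have "(pderiv ^^ l) R - (pderiv ^^ l) ([:-a, 1:] ^ l * Q) = [:int p:] * (pderiv ^^ l) E"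
    using E by (metis higher_pderiv_diff_int higher_pderiv_const_mult)
  then have "poly ((pderiv ^^ l) R) a - fact l * poly Q a = int p * poly ((pderiv ^^ l) E) a"
    by (metis higher_pderiv_root_power poly_diff poly_mult poly_pCons poly_0 mult_zero_right add_0_right)
  moreover have "int p dvd poly ((pderiv ^^ l) R) a" using Suc by simp
  ultimately have "int p dvd fact l * poly Q a"
    by (metis dvd_diff_right_iff dvd_triv_left)
  moreover have "\<not> int p dvd fact l"
    using assms(1) Suc.prems(1) prime_dvd_fact_iff[of p l]
    by (metis int_dvd_int_iff not_less_eq_eq of_nat_fact)
  ultimately have "int p dvd poly Q a"
    using assms(1) by (metis prime_dvd_mult_iff prime_int_nat_transfer int_dvd_int_iff prime_nat_int_transfer)
  from root_mod_factor[OF this] obtain Q' where "[:int p:] dvd Q - [:-a, 1:] * Q'" by blast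
  then have "[:int p:] dvd [:-a, 1:] ^ l * (Q - [:-a, 1:] * Q')" by (rule dvd_mult)
  from dvd_add[OF Q this] have "[:int p:] dvd R - [:-a, 1:] ^ Suc l * Q'"
    by (simp add: algebra_simps)
  then show ?case by blast
qed (auto intro!: exI[of _ R])

lemma prime_elem_const_int_poly:
  assumes "prime (p::nat)"
  shows "prime_elem [:int p:]"
  using assms by (simp add: lift_prime_elem_poly)

lemma linear_not_dvd_mod:
  assumes "prime (p::nat)"
  shows "\<not> [:int p:] dvd [:-a, 1:]"
proof
  assume "[:int p:] dvd [:-a, 1:]"
  then have "int p dvd coeff [:-a, 1:] 1" unfolding const_poly_dvd_iff by blast
  then show False using assms by (auto simp: prime_nat_iff)
qed

text \<open>Factors at different points are coprime modulo p. Instead of passing to polynomials over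
  the residue field, the proof uses that \<open>[:int p:]\<close> is a prime element of the integer
  polynomials: it does not divide x - b, so powers of x - b cancel.\<close>

lemma multiple_roots_mod_prod:
  fixes R :: "int poly" and p :: nat
  assumes p: "prime p" and "finite A"
    and "\<And>a b. a \<in> A \<Longrightarrow> b \<in> A \<Longrightarrow> a \<noteq> b \<Longrightarrow> \<not> int p dvd a - b"
    and "\<And>a. a \<in> A \<Longrightarrow> \<exists>Q. [:int p:] dvd R - [:-a, 1:] ^ l * Q"
  shows "\<exists>Q. [:int p:] dvd R - (\<Prod>a\<in>A. [:-a, 1:] ^ l) * Q"
  using assms(2-)
proof (induction A)
  case (insert b A)
  note prime_p = prime_elem_const_int_poly[OF p]
  let ?M = "\<Prod>a\<in>A. [:-a, 1:] ^ l"
  obtain Q where Q: "[:int p:] dvd R - ?M * Q" using insert by force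
  obtain Q2 where Q2: "[:int p:] dvd R - [:-b, 1:] ^ l * Q2" using insert by blast
  have Mb: "\<not> int p dvd poly ?M b"
  proof
    assume "int p dvd poly ?M b"
    then have "int p dvd (\<Prod>a\<in>A. (b - a) ^ l)" by (simp add: poly_prod poly_power)
    then obtain a where "a \<in> A" "int p dvd (b - a) ^ l"
      using p insert.hyps(1) by (auto simp: prime_dvd_prod_iff)
    then have "int p dvd b - a" using p prime_dvd_power by (metis prime_nat_int_transfer)
    with \<open>a \<in> A\<close> insert show False by blast
  qed
  \<comment> \<open>Q takes up the l factors x - b one at a time: (x - b)^i cancels from the two
    expressions for R, and for i < l the remaining power of x - b vanishes at b while
    \<open>?M\<close> does not.\<close>
  have "\<exists>Q'. [:int p:] dvd Q - [:-b, 1:] ^ i * Q'" if "i \<le> l" for i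
    using that
  proof (induction i)
    case (Suc i)
    then obtain Q' where Q': "[:int p:] dvd Q - [:-b, 1:] ^ i * Q'" by auto
    have l: "[:-b, 1:] ^ l = [:-b, 1:] ^ i * [:-b, 1:] ^ (l - i)"
      using Suc.prems by (simp flip: power_add)
    have "[:int p:] dvd ?M * (Q - [:-b, 1:] ^ i * Q')" using Q' by (rule dvd_mult)
    from dvd_add[OF Q this] have "[:int p:] dvd R - [:-b, 1:] ^ i * (?M * Q')"
      by (simp add: algebra_simps)
    from dvd_diff[OF Q2 this] have "[:int p:] dvd [:-b, 1:] ^ i * (?M * Q' - [:-b, 1:] ^ (l - i) * Q2)"
      unfolding l by (simp add: algebra_simps)
    then have "[:int p:] dvd ?M * Q' - [:-b, 1:] ^ (l - i) * Q2"
      using prime_p linear_not_dvd_mod[OF p, of b]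
      by (meson prime_elem_dvd_mult_iff prime_elem_dvd_power)
    from const_dvd_polyD[OF this, of b] have "int p dvd poly ?M b * poly Q' b"
      using Suc.prems by (simp add: poly_power zero_power)
    then have "int p dvd poly Q' b" using Mb p
      by (metis prime_dvd_mult_iff prime_nat_int_transfer)
    from root_mod_factor[OF this] obtain Q'' where "[:int p:] dvd Q' - [:-b, 1:] * Q''" by blast
    then have "[:int p:] dvd [:-b, 1:] ^ i * (Q' - [:-b, 1:] * Q'')" by (rule dvd_mult)
    from dvd_add[OF Q' this] have "[:int p:] dvd Q - [:-b, 1:] ^ Suc i * Q''"
      by (simp add: algebra_simps)
    then show ?case by blast
  qed (auto intro!: exI[of _ Q])
  from this[of l] obtain Q' where "[:int p:] dvd Q - [:-b, 1:] ^ l * Q'" by auto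
  then have "[:int p:] dvd ?M * (Q - [:-b, 1:] ^ l * Q')" by (rule dvd_mult)
  from dvd_add[OF Q this] have "[:int p:] dvd R - ([:-b, 1:] ^ l * ?M) * Q'"
    by (simp add: algebra_simps)
  then show ?case using insert.hyps by auto
qed (auto intro!: exI[of _ R])

text \<open>Let n be the largest index at which Q has a coefficient not divisible by c. As M is
  monic, the coefficient of M Q at \<open>degree M + n\<close> is this coefficient plus a multiple
  of c, so R has a nonzero coefficient there.\<close>

lemma monic_dvd_mod_degree_le:
  fixes R M Q :: "int poly"
  assumes RM: "[:c:] dvd R - M * Q" and M: "lead_coeff M = 1" and R: "\<not> [:c:] dvd R"
  shows "degree M \<le> degree R"
proof -
  have "\<not> [:c:] dvd Q"
  proof
    assume "[:c:] dvd Q"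
    then have "[:c:] dvd M * Q" by (rule dvd_mult)
    with RM have "[:c:] dvd R" by (metis dvd_add diff_add_cancel)
    with R show False ..
  qed
  define K where "K = {i. \<not> c dvd coeff Q i}"
  have "K \<noteq> {}" using \<open>\<not> [:c:] dvd Q\<close> by (auto simp: K_def const_poly_dvd_iff)
  have "K \<subseteq> {..degree Q}" unfolding K_def by (auto intro: le_degree)
  then have "finite K" by (rule finite_subset) simp
  define n where "n = Max K"
  have n: "n \<in> K" and max: "\<And>i. i \<in> K \<Longrightarrow> i \<le> n"
    using \<open>K \<noteq> {}\<close> \<open>finite K\<close> by (auto simp: n_def)
  let ?d = "degree M"
  let ?g = "\<lambda>i. coeff M i * coeff Q (?d + n - i)"
  have "coeff (M * Q) (?d + n) = (\<Sum>i\<in>{..?d + n}. ?g i)" by (simp add: coeff_mult)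
  also have "\<dots> = ?g ?d + (\<Sum>i\<in>{..?d + n} - {?d}. ?g i)" by (rule sum.remove) auto
  finally have "coeff (M * Q) (?d + n) = coeff Q n + (\<Sum>i\<in>{..?d + n} - {?d}. ?g i)"
    using M by simp
  moreover have "c dvd (\<Sum>i\<in>{..?d + n} - {?d}. ?g i)"
  proof (rule dvd_sum)
    fix i assume i: "i \<in> {..?d + n} - {?d}"
    show "c dvd ?g i"
    proof (cases "i < ?d")
      case True
      then have "?d + n - i > n" by simp
      with max have "?d + n - i \<notin> K" by force
      then show ?thesis by (simp add: K_def)
    qed (use i in \<open>simp add: coeff_eq_0\<close>)
  qed
  ultimately have "\<not> c dvd coeff (M * Q) (?d + n)"
    using n by (simp add: K_def dvd_add_left_iff)
  moreover have "c dvd coeff R (?d + n) - coeff (M * Q) (?d + n)"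
    using RM by (metis coeff_diff const_poly_dvd_iff)
  ultimately have "coeff R (?d + n) \<noteq> 0" by auto
  then show ?thesis using le_degree by fastforce
qed

text \<open>The zero estimate behind the counts below: with multiplicity l it drives Stepanov's
  argument, with l = 1 it bounds the number of roots of a cubic and shows that nonresidues
  exist.\<close>

lemma card_multiple_roots_mod_le_degree:
  fixes R :: "int poly" and p :: nat
  assumes p: "prime p" and A: "A \<subseteq> {0..<int p}" and l: "l \<le> p"
    and van: "\<And>a k. a \<in> A \<Longrightarrow> k < l \<Longrightarrow> int p dvd poly ((pderiv ^^ k) R) a"
    and R: "\<not> [:int p:] dvd R"
  shows "l * card A \<le> degree R"
proof -
  have finA: "finite A" using A finite_subset by blast
  have "\<not> int p dvd a - b" if "a \<in> A" "b \<in> A" "a \<noteq> b" for a b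
    using A that residue_dvd_diff_iff by blast
  then obtain Q where Q: "[:int p:] dvd R - (\<Prod>a\<in>A. [:-a, 1:] ^ l) * Q"
    using multiple_roots_mod_prod[OF p finA] multiple_root_mod[OF p l] van by meson
  have "degree (\<Prod>a\<in>A. [:-a, 1:] ^ l) \<le> degree R"
    by (rule monic_dvd_mod_degree_le[OF Q _ R]) (simp add: lead_coeff_prod lead_coeff_power)
  then show ?thesis
    by (simp add: degree_prod_sum_eq degree_power_eq mult.commute)
qed

text \<open>Siegel's pigeonhole argument; over \<open>\<F>\<^sub>p\<close> it replaces linear algebra.\<close>

lemma underdetermined_system_mod:
  fixes m :: "'v \<Rightarrow> 'u \<Rightarrow> int" and p :: nat
  assumes "p > 1" "finite U" "finite V" "card V < card U"
  shows "\<exists>c. (\<exists>u\<in>U. \<not> int p dvd c u) \<and> (\<forall>v\<in>V. int p dvd (\<Sum>u\<in>U. m v u * c u))"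
proof -
  define G where "G = (\<lambda>c. \<lambda>v\<in>V. (\<Sum>u\<in>U. m v u * c u) mod int p)"
  let ?C = "U \<rightarrow>\<^sub>E {0..<int p}" and ?D = "V \<rightarrow>\<^sub>E {0..<int p}"
  have "G ` ?C \<subseteq> ?D" using assms(1) by (auto simp: G_def)
  moreover have "card ?D < card ?C"
    using assms by (simp add: card_PiE)
  moreover have "finite ?D" using assms by (intro finite_PiE) auto
  ultimately have "\<not> inj_on G ?C"
    by (metis card_image card_mono not_le)
  then obtain c d where cd: "c \<in> ?C" "d \<in> ?C" "G c = G d" "c \<noteq> d"
    by (auto simp: inj_on_def)
  then obtain u where u: "c u \<noteq> d u" by blast
  have "u \<in> U" using cd u by (metis PiE_arb)
  have "\<not> int p dvd c u - d u"
  proof -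
    have "c u \<in> {0..<int p}" "d u \<in> {0..<int p}" using cd \<open>u \<in> U\<close> by auto
    then show ?thesis using u residue_dvd_diff_iff by blast
  qed
  moreover have "int p dvd (\<Sum>u\<in>U. m v u * (c u - d u))" if "v \<in> V" for v
  proof -
    have "G c v = G d v" using cd by simp
    then have "int p dvd (\<Sum>u\<in>U. m v u * c u) - (\<Sum>u\<in>U. m v u * d u)"
      using that by (simp add: G_def mod_eq_dvd_iff)
    then show ?thesis by (simp add: right_diff_distrib sum_subtractf)
  qed
  ultimately show ?thesis
    using \<open>u \<in> U\<close> by (intro exI[of _ "\<lambda>u. c u - d u"]) blast
qed

text \<open>Among the terms whose coefficient survives modulo q, the one of largest degree has no
  partner to cancel its leading term.\<close>

lemma monic_distinct_degrees_independent_mod: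
  fixes W :: "'u \<Rightarrow> int poly"
  assumes fin: "finite U" and inj: "inj_on (\<lambda>u. degree (W u)) U"
    and monic: "\<And>u. u \<in> U \<Longrightarrow> lead_coeff (W u) = 1"
    and c: "\<exists>u\<in>U. \<not> q dvd c u"
  shows "\<not> [:q:] dvd (\<Sum>u\<in>U. smult (c u) (W u))"
proof -
  define K where "K = {u\<in>U. \<not> q dvd c u}"
  have "finite K" "K \<noteq> {}" using fin c by (auto simp: K_def)
  define n where "n = Max ((\<lambda>u. degree (W u)) ` K)"
  have "n \<in> (\<lambda>u. degree (W u)) ` K"
    unfolding n_def using \<open>finite K\<close> \<open>K \<noteq> {}\<close> by (intro Max_in) auto
  then obtain w where w: "w \<in> K" "degree (W w) = n" by auto
  have max: "degree (W u) \<le> n" if "u \<in> K" for u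
    unfolding n_def using \<open>finite K\<close> that by simp
  have wU: "w \<in> U" using w by (simp add: K_def)
  have "coeff (\<Sum>u\<in>U. smult (c u) (W u)) n = (\<Sum>u\<in>U. c u * coeff (W u) n)"
    by (simp add: coeff_sum)
  also have "\<dots> = c w * coeff (W w) n + (\<Sum>u\<in>U-{w}. c u * coeff (W u) n)"
    using fin wU by (rule sum.remove)
  finally have "coeff (\<Sum>u\<in>U. smult (c u) (W u)) n = c w + (\<Sum>u\<in>U-{w}. c u * coeff (W u) n)"
    using monic[OF wU] w by simp
  moreover have "q dvd (\<Sum>u\<in>U-{w}. c u * coeff (W u) n)"
  proof (rule dvd_sum)
    fix u assume u: "u \<in> U - {w}"
    show "q dvd c u * coeff (W u) n"
    proof (cases "u \<in> K")
      case True
      then have "degree (W u) < n"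
        using max[OF True] u wU inj w by (metis DiffD1 DiffD2 inj_onD insertI1 le_neq_implies_less)
      then show ?thesis by (simp add: coeff_eq_0)
    qed (use u in \<open>auto simp: K_def\<close>)
  qed
  ultimately have "\<not> q dvd coeff (\<Sum>u\<in>U. smult (c u) (W u)) n"
    using w by (simp add: K_def dvd_add_left_iff)
  then show ?thesis by (simp add: const_poly_dvd_iff) blast
qed

section \<open>Stepanov's method for cubics\<close>

text \<open>\<open>stepanov_num f l h k e i\<close> is the numerator of the \<open>k\<close>-th derivative of
  \<open>f ^ (l + h * e) * x ^ i * x ^ (j * p)\<close>, which modulo \<open>p\<close> equals
  \<open>f ^ (l - k + h * e) * stepanov_num f l h k e i * x ^ (j * p)\<close>.\<close>

fun stepanov_num :: "int poly \<Rightarrow> nat \<Rightarrow> nat \<Rightarrow> nat \<Rightarrow> nat \<Rightarrow> nat \<Rightarrow> int poly" where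
  "stepanov_num f l h 0 e i = monom 1 i"
| "stepanov_num f l h (Suc k) e i =
    f * pderiv (stepanov_num f l h k e i)
      + of_nat (l - k + h * e) * (pderiv f * stepanov_num f l h k e i)"

lemma pderiv_power_of_nat:
  fixes f :: "int poly"
  shows "pderiv (f ^ Suc n) = of_nat (Suc n) * (f ^ n * pderiv f)"
  by (simp only: pderiv_power_Suc of_nat_poly) simp

lemma degree_stepanov_num_le:
  assumes f: "degree f \<le> 3"
  shows "degree (stepanov_num f l h k e i) \<le> i + 2 * k"
proof (induction k)
  case (Suc k)
  let ?D = "stepanov_num f l h k e i"
  have "degree (f * pderiv ?D) \<le> i + 2 * Suc k"
  proof (cases "degree ?D = 0")
    \<comment> \<open>A constant needs its own case: truncated subtraction makes
      \<open>3 + (degree ?D - 1)\<close> equal to 3 there, which exceeds the bound when i = k =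
      0.\<close>
    case True
    then have "pderiv ?D = 0" by (simp only: pderiv_eq_0_iff)
    then show ?thesis by simp
  next
    case False
    have "degree (f * pderiv ?D) \<le> degree f + degree (pderiv ?D)" by (rule degree_mult_le)
    also have "\<dots> \<le> 3 + (degree ?D - 1)" using f by (simp add: degree_pderiv)
    finally show ?thesis using Suc False by simp
  qed
  moreover have "degree (of_nat (l - k + h * e) * (pderiv f * ?D)) \<le> i + 2 * Suc k"
  proof -
    have "degree (of_nat (l - k + h * e) * (pderiv f * ?D)) \<le>
        degree (of_nat (l - k + h * e) :: int poly) + (degree (pderiv f) + degree ?D)"
      by (meson add_left_mono degree_mult_le order_trans)
    also have "\<dots> \<le> 2 + (i + 2 * k)"
      unfolding degree_of_nat using f Suc by (simp add: degree_pderiv)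
    finally show ?thesis by simp
  qed
  ultimately show ?case by (simp add: degree_add_le)
qed (simp add: degree_monom_eq)

text \<open>Modulo p the factor x^(j p) has derivative zero and passes through as a constant; each
  derivative lowers the power of f by one, which the extra exponent l pays for as long as k \<le>
  l.\<close>

lemma higher_pderiv_stepanov:
  fixes f :: "int poly"
  assumes "k \<le> l"
  shows "[:int p:] dvd (pderiv ^^ k) (f ^ (l + h * e) * monom 1 i * monom 1 (j * p))
    - f ^ (l - k + h * e) * stepanov_num f l h k e i * monom 1 (j * p)"
  using assms
proof (induction k)
  case (Suc k)
  let ?D = "stepanov_num f l h k e i" and ?Y = "monom 1 (j * p) :: int poly"
  let ?W = "(pderiv ^^ k) (f ^ (l + h * e) * monom 1 i * ?Y)"
  define n where "n = l - Suc k + h * e"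
  have n: "l - k + h * e = Suc n" using Suc.prems by (simp add: n_def)
  have "[:int p:] dvd ?W - f ^ Suc n * ?D * ?Y" using Suc by (simp flip: n)
  then obtain E where "?W - f ^ Suc n * ?D * ?Y = [:int p:] * E" by (elim dvdE)
  then have "pderiv ?W - pderiv (f ^ Suc n * ?D * ?Y) = pderiv ([:int p:] * E)"
    by (simp only: flip: pderiv_diff)
  also have "pderiv ([:int p:] * E) = [:int p:] * pderiv E" by (simp add: pderiv_smult)
  finally have 1: "[:int p:] dvd pderiv ?W - pderiv (f ^ Suc n * ?D * ?Y)"
    by (simp only: dvd_triv_left)
  have "pderiv ?Y = [:int p:] * monom (int j) (j * p - 1)"
    by (simp add: pderiv_monom smult_monom)
  then have 2: "[:int p:] dvd f ^ Suc n * ?D * pderiv ?Y" by (simp only: dvd_mult dvd_triv_left)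
  have "pderiv (f ^ Suc n * ?D * ?Y) =
      f ^ n * stepanov_num f l h (Suc k) e i * ?Y + f ^ Suc n * ?D * pderiv ?Y"
    by (simp only: stepanov_num.simps n pderiv_mult pderiv_power_of_nat)
       (simp add: algebra_simps)
  with dvd_add[OF 1 2] show ?case by (simp add: n_def)
qed simp

text \<open>The auxiliary polynomial R combines the products f^(l + h e) x^i x^(j p) with e in {0,
  1}. At a point a with f(a)^h = \<epsilon>, where also a^p = a, its k-th derivative is f(a)^(l - k)
  times the value of a polynomial of degree below N. So l N homogeneous conditions modulo p make R
  vanish to order l on all of A, and \<open>big\<close> says that the 2 I J unknowns outnumber them.
  As R does not vanish identically modulo p, l |A| is at most its degree.\<close>

lemma stepanov_count:
  fixes f :: "int poly" and p l J :: nat and \<epsilon> :: int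
  assumes p: "prime p" "odd p" and f: "degree f = 3" "lead_coeff f = 1"
    and l: "l \<le> p" and \<epsilon>: "\<epsilon> = 1 \<or> \<epsilon> = -1"
    and big: "l * ((p - 3) div 2 + J + 2 * l) < 2 * ((p - 3) div 2) * J"
  shows "l * card {a \<in> {0..<int p}. [poly f a ^ ((p - 1) div 2) = \<epsilon>] (mod int p)}
    \<le> 3 * l + (p - 3) div 2 + J * p + 3 * ((p - 1) div 2)"
proof -
  define I where "I = (p - 3) div 2"
  define h where "h = (p - 1) div 2"
  define A where "A = {a \<in> {0..<int p}. [poly f a ^ h = \<epsilon>] (mod int p)}"
  have p3: "p \<ge> 3" using p(2) prime_ge_2_nat[OF p(1)] by (cases "p = 2") auto
  have pI: "p = 2 * I + 3" using p(2) p3 unfolding I_def by presburger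
  have h: "h = I + 1" unfolding h_def using pI by simp
  \<comment> \<open>The choice of I gives 3 h = p + I: the factor f^h moves the degree modulo p by
    exactly I, so i < I keeps the ranges of i + I e for e = 0 and e = 1 disjoint and below
    p.\<close>
  define U where "U = {..<I} \<times> {..<J} \<times> {..<2::nat}"
  define N where "N = I + J + 2 * l"
  define V where "V = {..<l} \<times> {..<N}"
  define D where "D = stepanov_num f l h"
  \<comment> \<open>The condition polynomials after replacing x^p by x and f^h by \<epsilon>: x^(j
    p) has become x^j, which keeps the degree below I + J + 2 l instead of near J p.\<close>
  define E where "E = (\<lambda>k (i, j, e). [:\<epsilon> ^ e:] * (monom 1 j * D k e i))"
  define W where "W = (\<lambda>(i, j, e). f ^ (l + h * e) * monom 1 i * monom 1 (j * p))"
  have "card V < card U"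
    using big by (simp add: U_def V_def N_def I_def algebra_simps)
  then obtain c where c: "\<exists>u\<in>U. \<not> int p dvd c u"
    and sys: "\<And>v. v \<in> V \<Longrightarrow> int p dvd (\<Sum>u\<in>U. (case v of (k, n) \<Rightarrow> coeff (E k u) n) * c u)"
    using underdetermined_system_mod[of p U V "\<lambda>v u. case v of (k, n) \<Rightarrow> coeff (E k u) n"] p3
    by (auto simp: U_def V_def)
  define R where "R = (\<Sum>u\<in>U. smult (c u) (W u))"
  have f0: "f \<noteq> 0" using f by auto
  have degW: "degree (W (i, j, e)) = 3 * l + (i + I * e) + (j + e) * p" for i j e
    using f0 f(1) by (simp add: W_def degree_mult_eq degree_power_eq degree_monom_eq h pI algebra_simps)
  have monicW: "lead_coeff (W u) = 1" for u
    using f by (cases u) (simp add: W_def lead_coeff_mult lead_coeff_power degree_monom_eq)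
  have inj: "inj_on (\<lambda>u. degree (W u)) U"
  proof (rule inj_onI)
    fix u u' assume u: "u \<in> U" "u' \<in> U" "degree (W u) = degree (W u')"
    obtain i j e i' j' e' where eq: "u = (i, j, e)" "u' = (i', j', e')"
      by (metis prod_cases3)
    have lt: "i < I" "e < 2" "i' < I" "e' < 2" using u eq by (auto simp: U_def)
    have b: "i + I * e < p" "i' + I * e' < p"
      using lt pI by (auto simp: less_2_cases_iff)
    have "(i + I * e) + (j + e) * p = (i' + I * e') + (j' + e') * p"
      using u(3) by (simp add: eq degW)
    then have "((i + I * e) + (j + e) * p) mod p = ((i' + I * e') + (j' + e') * p) mod p"
      and "((i + I * e) + (j + e) * p) div p = ((i' + I * e') + (j' + e') * p) div p"
      by simp_all
    then have *: "i + I * e = i' + I * e'" "j + e = j' + e'"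
      using b by (simp_all only: mod_mult_self1 mod_less) (use b in simp)
    then have "(i + I * e) div I = (i' + I * e') div I" by simp
    then have "e = e'" using lt by simp
    with * show "u = u'" by (simp add: eq)
  qed
  have nz: "\<not> [:int p:] dvd R"
    unfolding R_def
    by (rule monic_distinct_degrees_independent_mod[OF _ inj monicW c]) (simp add: U_def)
  have "degree R \<le> 3 * l + I + J * p + 3 * h"
    unfolding R_def
  proof (rule degree_sum_le)
    fix u assume u: "u \<in> U"
    obtain i j e where eq: "u = (i, j, e)" by (metis prod_cases3)
    then have lt: "i < I" "j < J" "e < 2" using u by (auto simp: U_def)
    have "j * p \<le> J * p" "e = 0 \<or> e = 1" "3 * h = p + I" using lt h pI by auto
    moreover have "degree (W u) = 3 * l + i + I * e + j * p + e * p"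
      by (simp add: eq degW algebra_simps)
    moreover from calculation have "I * e + e * p \<le> 3 * h" by auto
    ultimately have "degree (W u) \<le> 3 * l + I + J * p + 3 * h"
      using lt(1) by linarith
    then show "degree (smult (c u) (W u)) \<le> 3 * l + I + J * p + 3 * h"
      using degree_smult_le order_trans by blast
  qed (simp add: U_def)
  moreover have "l * card A \<le> degree R"
  proof (rule card_multiple_roots_mod_le_degree[OF p(1) _ l _ nz])
    fix a k assume a: "a \<in> A" and k: "k < l"
    have ah: "[poly f a ^ h = \<epsilon>] (mod int p)" using a by (simp add: A_def)
    have ap: "[a ^ p = a] (mod int p)"
    proof (cases "int p dvd a")
      case True
      then have "int p dvd a ^ p" using p3 by (simp add: dvd_power_iff_le dvd_trans[OF _ dvd_power[of p a]])
      then show ?thesis using True by (simp add: cong_def dvd_eq_mod_eq_0)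
    next
      case False
      define b where "b = nat a"
      have b: "a = int b" using a by (simp add: b_def A_def)
      have "\<not> p dvd b" using False b by simp
      from fermat_theorem[OF p(1) this] have "[b ^ (p - 1) * b = 1 * b] (mod p)"
        by (rule cong_mult) simp
      then have "[b ^ p = b] (mod p)" using p3 by (simp flip: power_Suc2)
      then show ?thesis unfolding b by (metis cong_int_iff of_nat_power)
    qed
    have deg: "degree (\<Sum>u\<in>U. smult (c u) (E k u)) < N"
    proof (rule degree_sum_less)
      fix u assume u: "u \<in> U"
      obtain i j e where eq: "u = (i, j, e)" by (metis prod_cases3)
      then have lt: "i < I" "j < J" using u by (auto simp: U_def)
      have "degree (E k u) \<le> j + (i + 2 * k)"
      proof -
        have "degree (E k u) \<le> degree (monom 1 j * D k e i)" by (simp add: E_def eq degree_smult_le)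
        also have "\<dots> \<le> degree (monom (1::int) j) + degree (D k e i)" by (rule degree_mult_le)
        also have "\<dots> \<le> j + (i + 2 * k)"
          using degree_stepanov_num_le[of f l h k e i] f by (simp add: degree_monom_eq D_def)
        finally show ?thesis .
      qed
      then show "degree (smult (c u) (E k u)) < N"
        using lt k degree_smult_le[of "c u" "E k u"] by (simp add: N_def)
    qed (use k in \<open>simp add: N_def\<close>)
    have "[:int p:] dvd (\<Sum>u\<in>U. smult (c u) (E k u))"
      unfolding const_poly_dvd_iff
    proof
      fix n
      show "int p dvd coeff (\<Sum>u\<in>U. smult (c u) (E k u)) n"
      proof (cases "n < N")
        case True
        then show ?thesis using sys[of "(k, n)"] k
          by (simp add: V_def coeff_sum mult.commute)
      qed (use deg in \<open>simp add: coeff_eq_0\<close>)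
    qed
    from const_dvd_polyD[OF this, of a]
    have E0: "int p dvd (\<Sum>u\<in>U. c u * poly (E k u) a)" by (simp add: poly_sum)
    have Wk: "[poly ((pderiv ^^ k) (W u)) a = poly f a ^ (l - k) * poly (E k u) a] (mod int p)" for u
    proof -
      obtain i j e where eq: "u = (i, j, e)" by (metis prod_cases3)
      have "int p dvd poly ((pderiv ^^ k) (W u)
          - f ^ (l - k + h * e) * D k e i * monom 1 (j * p)) a"
        using higher_pderiv_stepanov[of k l p f h e i j] k
        by (intro const_dvd_polyD) (simp add: eq W_def D_def)
      then have "[poly ((pderiv ^^ k) (W u)) a =
          poly f a ^ (l - k) * (poly f a ^ h) ^ e * poly (D k e i) a * (a ^ p) ^ j] (mod int p)"
        by (simp add: cong_iff_dvd_diff poly_monom power_add power_mult mult.commute)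
           (simp add: algebra_simps flip: power_mult)
      moreover have "[poly f a ^ (l - k) * (poly f a ^ h) ^ e * poly (D k e i) a * (a ^ p) ^ j =
          poly f a ^ (l - k) * \<epsilon> ^ e * poly (D k e i) a * a ^ j] (mod int p)"
        by (intro cong_mult cong_pow ah ap cong_refl)
      ultimately show ?thesis
        by (simp add: eq E_def poly_monom cong_def algebra_simps)
    qed
    have "poly ((pderiv ^^ k) R) a = (\<Sum>u\<in>U. c u * poly ((pderiv ^^ k) (W u)) a)"
      by (simp add: R_def higher_pderiv_sum_smult poly_sum)
    moreover have "[(\<Sum>u\<in>U. c u * poly ((pderiv ^^ k) (W u)) a)
        = (\<Sum>u\<in>U. c u * (poly f a ^ (l - k) * poly (E k u) a))] (mod int p)"
      by (intro cong_sum cong_mult cong_refl Wk)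
    moreover have "(\<Sum>u\<in>U. c u * (poly f a ^ (l - k) * poly (E k u) a)) =
        poly f a ^ (l - k) * (\<Sum>u\<in>U. c u * poly (E k u) a)"
      by (simp add: sum_distrib_left algebra_simps)
    ultimately show "int p dvd poly ((pderiv ^^ k) R) a"
      using E0 by (metis cong_dvd_iff dvd_mult)
  qed (auto simp: A_def)
  ultimately show ?thesis
    by (simp add: A_def I_def h_def)
qed

section \<open>From point counts to cubic character sums\<close>

lemma floor_sqrt_exists: "\<exists>t. t\<^sup>2 \<le> n \<and> n < (t + 1)\<^sup>2" for n :: nat
proof (induction n)
  case (Suc n)
  then obtain t where t: "t\<^sup>2 \<le> n" "n < (t + 1)\<^sup>2" by blast
  show ?case
  proof (cases "Suc n < (t + 1)\<^sup>2")
    case False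
    then have "Suc n = (t + 1)\<^sup>2" using t by simp
    then show ?thesis by (intro exI[of _ "t + 1"]) (simp add: power2_eq_square)
  qed (use t in \<open>auto intro!: exI[of _ t]\<close>)
qed (auto intro!: exI[of _ 0])

text \<open>Euler's criterion turns the values 1 and -1 into the two cases of
  \<open>stepanov_count\<close>. Each class has at most p/2 + O(sqrt p) points; as both together
  miss at most three zeros of f, the upper bound for one class is a lower bound for the other. Odd
  degree keeps f from being a constant times a square.\<close>

theorem cubic_Legendre_sum_bound:
  fixes f :: "int poly" and p :: nat
  assumes p: "prime p" "odd p" and f: "degree f = 3" "lead_coeff f = 1"
  shows "(\<Sum>a\<in>{0..<int p}. Legendre (poly f a) (int p))\<^sup>2 \<le> 1000 * int p"
proof -
  define L where "L = (\<lambda>a. Legendre (poly f a) (int p))"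
  define n where "n = (\<lambda>\<epsilon>. card {a \<in> {0..<int p}. L a = \<epsilon>})"
  have p2: "2 < p" using p by (metis dvd_refl le_neq_implies_less prime_ge_2_nat)
  have L: "L a \<in> {0, 1, -1}" for a by (auto simp: L_def Legendre_def)
  have sum_L: "(\<Sum>a\<in>{0..<int p}. g (L a)) =
      of_nat (n 0) * g 0 + of_nat (n 1) * g 1 + of_nat (n (-1)) * g (-1)" for g :: "int \<Rightarrow> int"
  proof -
    have "(\<Sum>a\<in>{0..<int p}. g (L a)) = (\<Sum>\<epsilon>\<in>{0, 1, -1}. \<Sum>a\<in>{a \<in> {0..<int p}. L a = \<epsilon>}. g (L a))"
      by (rule sum.group[symmetric]) (use L in auto)
    also have "\<dots> = (\<Sum>\<epsilon>\<in>{0, 1, -1}. of_nat (n \<epsilon>) * g \<epsilon>)"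
      by (rule sum.cong) (auto simp: n_def)
    finally show ?thesis by simp
  qed
  have S: "(\<Sum>a\<in>{0..<int p}. L a) = int (n 1) - int (n (-1))" using sum_L[of "\<lambda>x. x"] by simp
  have total: "int p = int (n 0) + int (n 1) + int (n (-1))" using sum_L[of "\<lambda>x. 1"] by simp
  have "\<not> int p dvd coeff f 3" using f p2 by simp
  then have "\<not> [:int p:] dvd f" unfolding const_poly_dvd_iff by blast
  then have "1 * n 0 \<le> degree f"
    unfolding n_def
    by (intro card_multiple_roots_mod_le_degree[OF p(1)])
       (use p2 in \<open>auto simp: L_def Legendre_def cong_0_iff split: if_splits\<close>)
  then have n0: "int (n 0) \<le> 3" using f by simp
  show ?thesis
  proof (cases "p < 36")
    case True
    have "\<bar>int (n 1) - int (n (-1))\<bar> \<le> int p" using total by simp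
    then have "(int (n 1) - int (n (-1)))\<^sup>2 \<le> (int p)\<^sup>2" by (metis abs_le_square_iff abs_of_nat)
    also have "\<dots> \<le> 1000 * int p" using True by (simp add: power2_eq_square mult_right_mono)
    finally show ?thesis using S by (simp add: L_def)
  next
    case False
    \<comment> \<open>t is the integer part of sqrt(p)/2. The parameters below are l = 2 t and J = t
      + 4, for which the main term J p / l of the count exceeds p/2 only by 2 p / t = O(sqrt
      p).\<close>
    obtain t where "t\<^sup>2 \<le> p div 4" "p div 4 < (t + 1)\<^sup>2" using floor_sqrt_exists by blast
    then have t: "4 * t\<^sup>2 \<le> p" "p < 4 * (t + 1)\<^sup>2" by linarith+
    have t3: "t \<ge> 3"
    proof (rule ccontr)
      assume "\<not> t \<ge> 3"
      then have "(t + 1)\<^sup>2 \<le> 3\<^sup>2" by (intro power_mono) auto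
      with t(2) False show False by simp
    qed
    have sq: "3 * t \<le> t\<^sup>2" using t3 by (simp add: power2_eq_square)
    define q where "q = (p - 3) div 2"
    have q: "p = 2 * q + 3" using p(2) p2 unfolding q_def by presburger
    have bound: "2 * int (n \<epsilon>) \<le> int p + 24 * int t + 60" if "\<epsilon> = 1 \<or> \<epsilon> = -1" for \<epsilon>
    proof -
      let ?C = "{a \<in> {0..<int p}. [poly f a ^ ((p - 1) div 2) = \<epsilon>] (mod int p)}"
      have "{a \<in> {0..<int p}. L a = \<epsilon>} \<subseteq> ?C"
        using euler_criterion[OF p(1) p2] by (auto simp: L_def cong_sym_eq)
      then have "n \<epsilon> \<le> card ?C" unfolding n_def
        by (rule card_mono[rotated]) (auto intro: finite_subset[of _ "{0..<int p}"])
      then have "2 * t * n \<epsilon> \<le> 2 * t * card ?C" by (rule mult_le_mono2)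
      also have "2 * t * card ?C \<le>
          3 * (2 * t) + (p - 3) div 2 + (t + 4) * p + 3 * ((p - 1) div 2)"
      proof (rule stepanov_count[OF p f _ that])
        show "2 * t \<le> p" using t sq by simp
        \<comment> \<open>The terms in t q cancel from the counting condition; the 4 in J = t + 4
          leaves 8 q, about 16 t^2, against 10 t^2 + 8 t.\<close>
        have "10 * t\<^sup>2 + 8 * t < 8 * q" using t q sq t3 by simp
        then show "2 * t * ((p - 3) div 2 + (t + 4) + 2 * (2 * t)) < 2 * ((p - 3) div 2) * (t + 4)"
          by (simp add: q power2_eq_square algebra_simps)
      qed
      also have "\<dots> \<le> 6 * t + (t + 6) * p" using q by (simp add: algebra_simps)
      also have "\<dots> \<le> t * (p + 24 * t + 60)"
        using t t3 by (simp add: algebra_simps power2_eq_square)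
      finally have "t * (2 * n \<epsilon>) \<le> t * (p + 24 * t + 60)" by (simp add: algebra_simps)
      then have "2 * n \<epsilon> \<le> p + 24 * t + 60" using t3 by simp
      then show ?thesis by linarith
    qed
    \<comment> \<open>There are at least p - 3 nonzero values, so the difference is at most 24 t +
      63, which is at most 45 t for t \<ge> 3. Since 4 t^2 \<le> p, its square is at most 2025 p /
      4.\<close>
    have "\<bar>int (n 1) - int (n (-1))\<bar> \<le> 45 * int t"
      using bound[of 1] bound[of "-1"] total n0 t3 by linarith
    then have "(int (n 1) - int (n (-1)))\<^sup>2 \<le> (45 * int t)\<^sup>2"
      by (metis abs_le_square_iff abs_of_nat of_nat_mult of_nat_numeral)
    also have "\<dots> = 2025 * int (t\<^sup>2)" by (simp add: power_mult_distrib)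
    also have "\<dots> \<le> 1000 * int p" using t(1) by linarith
    finally show ?thesis using S by (simp add: L_def)
  qed
qed

section \<open>Matrices invariant under an affine group\<close>

text \<open>The usual proof without normalising: s is n times the orthogonal projection of u onto
  the span of the family, and the squared norm of n u - s is nonnegative. As u is real, the
  unconjugated coefficients c have the right modulus.\<close>

lemma bessel_equal_norms:
  fixes w :: "'i \<Rightarrow> 'x \<Rightarrow> complex" and u :: "'x \<Rightarrow> real" and n :: real
  assumes fin: "finite A" "finite X" and n: "n \<ge> 0"
    and orth: "\<And>\<alpha> \<beta>. \<alpha> \<in> A \<Longrightarrow> \<beta> \<in> A \<Longrightarrow> \<alpha> \<noteq> \<beta> \<Longrightarrow> (\<Sum>x\<in>X. w \<alpha> x * cnj (w \<beta> x)) = 0"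
    and norm: "\<And>\<alpha>. \<alpha> \<in> A \<Longrightarrow> (\<Sum>x\<in>X. (cmod (w \<alpha> x))\<^sup>2) = n"
  shows "(\<Sum>\<alpha>\<in>A. (cmod (\<Sum>x\<in>X. of_real (u x) * w \<alpha> x))\<^sup>2) \<le> n * (\<Sum>x\<in>X. (u x)\<^sup>2)"
proof (cases "n = 0")
  case True
  then have "w \<alpha> x = 0" if "\<alpha> \<in> A" "x \<in> X" for \<alpha> x
    using norm[OF that(1)] that fin by (simp add: sum_nonneg_eq_0_iff)
  then show ?thesis using True by simp
next
  case False
  define c where "c = (\<lambda>\<alpha>. \<Sum>x\<in>X. of_real (u x) * w \<alpha> x)"
  define K where "K = (\<Sum>\<alpha>\<in>A. (cmod (c \<alpha>))\<^sup>2)"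
  define s where "s = (\<lambda>x. \<Sum>\<alpha>\<in>A. cnj (c \<alpha>) * w \<alpha> x)"
  have "(\<Sum>x\<in>X. of_real (u x) * s x) = (\<Sum>\<alpha>\<in>A. cnj (c \<alpha>) * (\<Sum>x\<in>X. of_real (u x) * w \<alpha> x))"
    unfolding s_def sum_distrib_left by (subst sum.swap) (simp add: mult.left_commute)
  also have "\<dots> = of_real K"
    unfolding K_def of_real_sum complex_norm_square by (simp add: c_def mult.commute)
  finally have "Re (\<Sum>x\<in>X. of_real (u x) * s x) = K" by simp
  then have us: "(\<Sum>x\<in>X. u x * Re (s x)) = K" by simp
  have cnj_s: "cnj (s x) = (\<Sum>\<beta>\<in>A. c \<beta> * cnj (w \<beta> x))" for x
    by (simp add: s_def)
  have "(\<Sum>x\<in>X. s x * cnj (s x)) =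
      (\<Sum>x\<in>X. \<Sum>\<alpha>\<in>A. \<Sum>\<beta>\<in>A. (cnj (c \<alpha>) * w \<alpha> x) * (c \<beta> * cnj (w \<beta> x)))"
    unfolding cnj_s by (simp only: s_def sum_product)
  also have "\<dots> = (\<Sum>x\<in>X. \<Sum>\<alpha>\<in>A. \<Sum>\<beta>\<in>A. cnj (c \<alpha>) * c \<beta> * (w \<alpha> x * cnj (w \<beta> x)))"
    by (simp only: mult_ac)
  also have "\<dots> = (\<Sum>\<alpha>\<in>A. \<Sum>\<beta>\<in>A. cnj (c \<alpha>) * c \<beta> * (\<Sum>x\<in>X. w \<alpha> x * cnj (w \<beta> x)))"
    by (subst sum.swap, rule sum.cong[OF refl], subst sum.swap) (simp add: sum_distrib_left)
  also have "\<dots> = (\<Sum>\<alpha>\<in>A. \<Sum>\<beta>\<in>A. if \<beta> = \<alpha> then of_real ((cmod (c \<alpha>))\<^sup>2 * n) else 0)"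
  proof (intro sum.cong refl)
    fix \<alpha> \<beta> assume ab: "\<alpha> \<in> A" "\<beta> \<in> A"
    have "(\<Sum>x\<in>X. w \<alpha> x * cnj (w \<alpha> x)) = of_real n"
      unfolding norm[OF ab(1), symmetric] of_real_sum complex_norm_square ..
    then show "cnj (c \<alpha>) * c \<beta> * (\<Sum>x\<in>X. w \<alpha> x * cnj (w \<beta> x)) =
        (if \<beta> = \<alpha> then of_real ((cmod (c \<alpha>))\<^sup>2 * n) else 0)"
      using orth[OF ab] by (simp add: complex_norm_square mult_ac del: of_real_power)
  qed
  also have "\<dots> = of_real (n * K)"
    using fin by (simp add: K_def sum_distrib_left mult.commute)
  finally have "of_real (\<Sum>x\<in>X. (cmod (s x))\<^sup>2) = complex_of_real (n * K)"
    unfolding of_real_sum complex_norm_square .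
  then have ss: "(\<Sum>x\<in>X. (cmod (s x))\<^sup>2) = n * K" by (simp only: of_real_eq_iff)
  have "0 \<le> (\<Sum>x\<in>X. (n * u x - Re (s x))\<^sup>2 + (Im (s x))\<^sup>2)" by (intro sum_nonneg) simp
  also have "\<dots> = (\<Sum>x\<in>X. n\<^sup>2 * (u x)\<^sup>2 - 2 * n * (u x * Re (s x)) + (cmod (s x))\<^sup>2)"
    unfolding cmod_power2 by (intro sum.cong refl) (simp add: power2_eq_square algebra_simps)
  also have "\<dots> = n\<^sup>2 * (\<Sum>x\<in>X. (u x)\<^sup>2) - 2 * n * (\<Sum>x\<in>X. u x * Re (s x)) + (\<Sum>x\<in>X. (cmod (s x))\<^sup>2)"
    by (simp add: sum.distrib sum_subtractf sum_distrib_left)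
  also have "\<dots> = n * (n * (\<Sum>x\<in>X. (u x)\<^sup>2) - K)"
    unfolding us ss by (simp add: power2_eq_square algebra_simps)
  finally have "K \<le> n * (\<Sum>x\<in>X. (u x)\<^sup>2)" using n False by (simp add: zero_le_mult_iff)
  then show ?thesis by (simp add: K_def c_def)
qed

lemma sum_shift_mod:
  fixes p :: nat and s :: int
  assumes "p > 0"
  shows "(\<Sum>t\<in>{0..<int p}. F ((t + s) mod int p)) = (\<Sum>t\<in>{0..<int p}. F t)"
proof (rule sum.reindex_bij_witness[of _ "\<lambda>t. (t - s) mod int p" "\<lambda>t. (t + s) mod int p"])
qed (use assms in \<open>auto simp: mod_simps\<close>)

section \<open>Additive characters modulo p\<close>

definition unit_root :: "nat \<Rightarrow> int \<Rightarrow> complex" where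
  "unit_root p n = cis (2 * pi * of_int n / of_nat p)"

lemma unit_root_add: "unit_root p (m + n) = unit_root p m * unit_root p n"
  by (simp add: unit_root_def cis_mult ring_distribs add_divide_distrib)

lemma unit_root_diff: "unit_root p (m - n) = unit_root p m * unit_root p (- n)"
  using unit_root_add[of p m "- n"] by simp

lemma unit_root_0 [simp]: "unit_root p 0 = 1"
  by (simp add: unit_root_def)

lemma cnj_unit_root: "cnj (unit_root p n) = unit_root p (- n)"
  by (simp add: unit_root_def cis_cnj)

lemma unit_root_eq_1_iff:
  assumes "p > 0"
  shows "unit_root p n = 1 \<longleftrightarrow> int p dvd n"
proof -
  have "unit_root p n = 1 \<longleftrightarrow> (\<exists>m. 2 * pi * of_int n / of_nat p = of_int m * (2 * pi))"
    by (simp add: unit_root_def cis_eq_1_iff)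
  also have "\<dots> \<longleftrightarrow> (\<exists>m. real_of_int n = of_int (int p * m))"
    using assms by (simp add: field_simps)
  also have "\<dots> \<longleftrightarrow> int p dvd n" unfolding of_int_eq_iff by (auto simp: dvd_def)
  finally show ?thesis .
qed

lemma unit_root_cong:
  assumes "p > 0" "[m = n] (mod int p)"
  shows "unit_root p m = unit_root p n"
proof -
  have "unit_root p m = unit_root p (m - n) * unit_root p n"
    by (simp flip: unit_root_add)
  then show ?thesis
    using assms by (simp add: unit_root_eq_1_iff cong_iff_dvd_diff)
qed

lemma unit_root_sum:
  assumes "p > 0"
  shows "(\<Sum>k\<in>{0..<int p}. unit_root p (k * m)) = (if int p dvd m then of_nat p else 0)"
proof (cases "int p dvd m")
  case True
  then have "unit_root p (k * m) = 1" for k using assms by (simp add: unit_root_eq_1_iff)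
  then show ?thesis using True by simp
next
  case False
  let ?S = "\<Sum>k\<in>{0..<int p}. unit_root p (k * m)"
  have "?S = (\<Sum>k\<in>{0..<int p}. unit_root p ((k + 1) mod int p * m))"
    using sum_shift_mod[OF assms, of "\<lambda>k. unit_root p (k * m)" 1] by simp
  also have "\<dots> = (\<Sum>k\<in>{0..<int p}. unit_root p m * unit_root p (k * m))"
    by (intro sum.cong refl)
       (simp flip: unit_root_add, intro unit_root_cong assms,
        simp add: cong_def mod_simps algebra_simps)
  also have "\<dots> = unit_root p m * ?S" by (simp add: sum_distrib_left)
  finally show ?thesis using False assms by (simp add: unit_root_eq_1_iff)
qed

lemma unit_root_parseval:
  fixes a :: "int \<Rightarrow> real"
  assumes "p > 0"
  shows "(\<Sum>k\<in>{0..<int p}. (cmod (\<Sum>t\<in>{0..<int p}. unit_root p (- (k * t)) * of_real (a t)))\<^sup>2)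
    = real p * (\<Sum>t\<in>{0..<int p}. (a t)\<^sup>2)"
proof -
  let ?P = "{0..<int p}"
  let ?z = "\<lambda>k. \<Sum>t\<in>?P. unit_root p (- (k * t)) * of_real (a t)"
  have "cnj (?z k) = (\<Sum>s\<in>?P. unit_root p (k * s) * of_real (a s))" for k
    by (simp add: cnj_unit_root)
  then have "(\<Sum>k\<in>?P. ?z k * cnj (?z k)) =
      (\<Sum>k\<in>?P. \<Sum>t\<in>?P. \<Sum>s\<in>?P.
        (unit_root p (- (k * t)) * of_real (a t)) * (unit_root p (k * s) * of_real (a s)))"
    by (simp only: sum_product)
  also have "\<dots> = (\<Sum>k\<in>?P. \<Sum>t\<in>?P. \<Sum>s\<in>?P. of_real (a t * a s) * unit_root p (k * (s - t)))"
    by (simp add: right_diff_distrib unit_root_diff mult_ac)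
  also have "\<dots> = (\<Sum>t\<in>?P. \<Sum>s\<in>?P. of_real (a t * a s) * (\<Sum>k\<in>?P. unit_root p (k * (s - t))))"
    by (subst sum.swap, rule sum.cong[OF refl], subst sum.swap) (simp add: sum_distrib_left)
  also have "\<dots> = (\<Sum>t\<in>?P. \<Sum>s\<in>?P. if s = t then of_real (real p * (a t)\<^sup>2) else 0)"
  proof (intro sum.cong refl)
    fix t s assume ts: "t \<in> ?P" "s \<in> ?P"
    have "int p dvd s - t \<longleftrightarrow> s = t"
      by (rule residue_dvd_diff_iff[OF ts(2,1)])
    then show "of_real (a t * a s) * (\<Sum>k\<in>?P. unit_root p (k * (s - t))) =
        (if s = t then complex_of_real (real p * (a t)\<^sup>2) else 0)"
      using assms by (simp add: unit_root_sum power2_eq_square)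
  qed
  also have "\<dots> = of_real (real p * (\<Sum>t\<in>?P. (a t)\<^sup>2))"
    by (simp add: sum_distrib_left)
  finally have "complex_of_real (\<Sum>k\<in>?P. (cmod (?z k))\<^sup>2) = of_real (real p * (\<Sum>t\<in>?P. (a t)\<^sup>2))"
    unfolding of_real_sum complex_norm_square .
  then show ?thesis by (simp only: of_real_eq_iff)
qed

section \<open>Norm bounds from translations and dilations\<close>

locale affine_action =
  fixes p :: nat and X :: "'x set" and \<sigma> \<delta> :: "int \<Rightarrow> 'x \<Rightarrow> 'x" and B :: "'x \<Rightarrow> 'x \<Rightarrow> real"
  assumes p: "prime p" and finX: "finite X"
    and bij_\<sigma>: "bij_betw (\<sigma> t) X X"
    and \<sigma>_add: "x \<in> X \<Longrightarrow> \<sigma> s (\<sigma> t x) = \<sigma> (s + t) x"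
    and \<sigma>_mod: "x \<in> X \<Longrightarrow> \<sigma> (t mod int p) x = \<sigma> t x"
    and bij_\<delta>: "\<alpha> \<in> {1..<int p} \<Longrightarrow> bij_betw (\<delta> \<alpha>) X X"
    and \<delta>_\<sigma>: "\<alpha> \<in> {1..<int p} \<Longrightarrow> x \<in> X \<Longrightarrow> \<delta> \<alpha> (\<sigma> t x) = \<sigma> (\<alpha> * t) (\<delta> \<alpha> x)"
    and B_\<sigma>: "x \<in> X \<Longrightarrow> y \<in> X \<Longrightarrow> B (\<sigma> t x) (\<sigma> t y) = B x y"
    and B_\<delta>: "\<alpha> \<in> {1..<int p} \<Longrightarrow> x \<in> X \<Longrightarrow> y \<in> X \<Longrightarrow> B (\<delta> \<alpha> x) (\<delta> \<alpha> y) = B x y"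
begin

lemma p_pos: "p > 0"
  using p prime_gt_0_nat by blast

lemma \<sigma>_in: "x \<in> X \<Longrightarrow> \<sigma> t x \<in> X"
  using bij_\<sigma> by (rule bij_betw_apply)

lemma \<delta>_in: "\<alpha> \<in> {1..<int p} \<Longrightarrow> x \<in> X \<Longrightarrow> \<delta> \<alpha> x \<in> X"
  using bij_\<delta> by (rule bij_betw_apply)

lemma sum_\<sigma>: "(\<Sum>x\<in>X. F (\<sigma> t x)) = (\<Sum>x\<in>X. F x)"
  using bij_\<sigma> by (rule sum.reindex_bij_betw)

lemma sum_\<delta>: "\<alpha> \<in> {1..<int p} \<Longrightarrow> (\<Sum>x\<in>X. F (\<delta> \<alpha> x)) = (\<Sum>x\<in>X. F x)"
  using bij_\<delta> by (rule sum.reindex_bij_betw)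

lemma sum_\<sigma>_shift:
  assumes "x \<in> X"
  shows "(\<Sum>t\<in>{0..<int p}. F (\<sigma> t (\<sigma> s x))) = (\<Sum>t\<in>{0..<int p}. F (\<sigma> t x))"
proof -
  have "(\<Sum>t\<in>{0..<int p}. F (\<sigma> t (\<sigma> s x))) = (\<Sum>t\<in>{0..<int p}. F (\<sigma> ((t + s) mod int p) x))"
    using assms by (simp add: \<sigma>_add \<sigma>_mod)
  also have "\<dots> = (\<Sum>t\<in>{0..<int p}. F (\<sigma> t x))"
    by (rule sum_shift_mod[OF p_pos])
  finally show ?thesis .
qed

text \<open>The dilates of w belong to the translation characters k \<alpha>, which are distinct for
  1 \<le> \<alpha> < p because p does not divide k. They are p - 1 orthogonal functions of equal
  norm, and their images under B, which commutes with dilations, again have equal norm. Bessel's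
  inequality for each row of B against this family, summed over the rows, gives the factor p -
  1.\<close>

lemma character_component_bound:
  fixes w :: "'x \<Rightarrow> complex" and k :: int
  assumes k: "\<not> int p dvd k" and w: "\<And>x t. x \<in> X \<Longrightarrow> w (\<sigma> t x) = unit_root p (k * t) * w x"
  shows "real (p - 1) * (\<Sum>x\<in>X. (cmod (\<Sum>y\<in>X. of_real (B x y) * w y))\<^sup>2)
    \<le> (\<Sum>x\<in>X. \<Sum>y\<in>X. (B x y)\<^sup>2) * (\<Sum>y\<in>X. (cmod (w y))\<^sup>2)"
proof -
  let ?A = "{1..<int p}"
  define n where "n = (\<Sum>y\<in>X. (cmod (w y))\<^sup>2)"
  define W where "W = (\<lambda>\<alpha> x. w (\<delta> \<alpha> x))"
  define f where "f = (\<lambda>x. \<Sum>y\<in>X. of_real (B x y) * w y)"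
  have W_\<sigma>: "W \<alpha> (\<sigma> t x) = unit_root p (k * (\<alpha> * t)) * W \<alpha> x" if "\<alpha> \<in> ?A" "x \<in> X" for \<alpha> t x
    using that by (simp add: W_def \<delta>_\<sigma> w \<delta>_in)
  have orth: "(\<Sum>x\<in>X. W \<alpha> x * cnj (W \<beta> x)) = 0" if ab: "\<alpha> \<in> ?A" "\<beta> \<in> ?A" "\<alpha> \<noteq> \<beta>" for \<alpha> \<beta>
  proof -
    let ?S = "\<Sum>x\<in>X. W \<alpha> x * cnj (W \<beta> x)"
    have "?S = (\<Sum>x\<in>X. W \<alpha> (\<sigma> 1 x) * cnj (W \<beta> (\<sigma> 1 x)))"
      by (rule sum_\<sigma>[symmetric])
    also have "\<dots> = (\<Sum>x\<in>X. unit_root p (k * (\<alpha> - \<beta>)) * (W \<alpha> x * cnj (W \<beta> x)))"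
      using ab by (intro sum.cong refl)
        (simp add: W_\<sigma> cnj_unit_root right_diff_distrib unit_root_diff)
    also have "\<dots> = unit_root p (k * (\<alpha> - \<beta>)) * ?S" by (simp add: sum_distrib_left)
    finally have "unit_root p (k * (\<alpha> - \<beta>)) = 1 \<or> ?S = 0" by auto
    moreover have "\<not> int p dvd \<alpha> - \<beta>"
      using ab residue_dvd_diff_iff[of \<alpha> "int p" \<beta>] by simp
    then have "\<not> int p dvd k * (\<alpha> - \<beta>)"
      using k p by (simp add: prime_dvd_mult_iff)
    ultimately show ?thesis by (simp add: unit_root_eq_1_iff p_pos)
  qed
  have norm: "(\<Sum>x\<in>X. (cmod (W \<alpha> x))\<^sup>2) = n" if "\<alpha> \<in> ?A" for \<alpha>
    using sum_\<delta>[OF that, of "\<lambda>x. (cmod (w x))\<^sup>2"] by (simp add: W_def n_def)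
  have f_\<delta>: "(\<Sum>y\<in>X. of_real (B x y) * W \<alpha> y) = f (\<delta> \<alpha> x)" if "\<alpha> \<in> ?A" "x \<in> X" for \<alpha> x
  proof -
    have "(\<Sum>y\<in>X. of_real (B x y) * W \<alpha> y) = (\<Sum>y\<in>X. of_real (B (\<delta> \<alpha> x) (\<delta> \<alpha> y)) * w (\<delta> \<alpha> y))"
      using that by (simp add: W_def B_\<delta>)
    also have "\<dots> = f (\<delta> \<alpha> x)"
      unfolding f_def by (rule sum_\<delta>[OF that(1), of "\<lambda>z. of_real (B (\<delta> \<alpha> x) z) * w z"])
    finally show ?thesis .
  qed
  have "real (p - 1) * (\<Sum>x\<in>X. (cmod (f x))\<^sup>2) = (\<Sum>\<alpha>\<in>?A. \<Sum>x\<in>X. (cmod (f (\<delta> \<alpha> x)))\<^sup>2)"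
    using p_pos by (simp add: sum_\<delta>[of _ "\<lambda>x. (cmod (f x))\<^sup>2"])
  also have "\<dots> = (\<Sum>x\<in>X. \<Sum>\<alpha>\<in>?A. (cmod (\<Sum>y\<in>X. of_real (B x y) * W \<alpha> y))\<^sup>2)"
    by (subst sum.swap) (simp add: f_\<delta>)
  also have "\<dots> \<le> (\<Sum>x\<in>X. n * (\<Sum>y\<in>X. (B x y)\<^sup>2))"
    by (intro sum_mono bessel_equal_norms finX orth norm) (auto simp: n_def intro: sum_nonneg)
  also have "\<dots> = (\<Sum>x\<in>X. \<Sum>y\<in>X. (B x y)\<^sup>2) * n"
    by (simp add: sum_distrib_left mult.commute)
  finally show ?thesis by (simp add: f_def n_def)
qed

text \<open>Fourier analysis along translation orbits splits v into character components on which B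
  acts separately; the hypothesis removes the trivial character, the only one that dilations do not
  move. Plancherel for v and for its image reassembles the component bounds.\<close>

lemma mean_zero_bound:
  fixes v :: "'x \<Rightarrow> real"
  assumes v: "\<And>x. x \<in> X \<Longrightarrow> (\<Sum>t\<in>{0..<int p}. v (\<sigma> t x)) = 0"
  shows "real (p - 1) * (\<Sum>x\<in>X. (\<Sum>y\<in>X. B x y * v y)\<^sup>2)
    \<le> (\<Sum>x\<in>X. \<Sum>y\<in>X. (B x y)\<^sup>2) * (\<Sum>y\<in>X. (v y)\<^sup>2)"
proof -
  let ?P = "{0..<int p}"
  define F where "F = (\<Sum>x\<in>X. \<Sum>y\<in>X. (B x y)\<^sup>2)"
  define g where "g = (\<lambda>x. \<Sum>y\<in>X. B x y * v y)"
  \<comment> \<open>Not divided by p, whence the factor p^2 in \<open>plancherel\<close>, which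
    cancels at the end.\<close>
  define comp where
    "comp = (\<lambda>(u :: 'x \<Rightarrow> real) k x. \<Sum>t\<in>?P. unit_root p (- (k * t)) * of_real (u (\<sigma> t x)))"
  have plancherel: "(\<Sum>k\<in>?P. \<Sum>x\<in>X. (cmod (comp u k x))\<^sup>2) = (real p)\<^sup>2 * (\<Sum>x\<in>X. (u x)\<^sup>2)"
    for u :: "'x \<Rightarrow> real"
  proof -
    have "(\<Sum>k\<in>?P. \<Sum>x\<in>X. (cmod (comp u k x))\<^sup>2) = (\<Sum>x\<in>X. real p * (\<Sum>t\<in>?P. (u (\<sigma> t x))\<^sup>2))"
      unfolding comp_def by (subst sum.swap) (simp add: unit_root_parseval[OF p_pos])
    also have "\<dots> = real p * (\<Sum>t\<in>?P. \<Sum>x\<in>X. (u (\<sigma> t x))\<^sup>2)"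
      by (subst sum.swap) (simp add: sum_distrib_left)
    also have "\<dots> = (real p)\<^sup>2 * (\<Sum>x\<in>X. (u x)\<^sup>2)"
      unfolding sum_\<sigma>[of "\<lambda>x. (u x)\<^sup>2"] by (simp add: power2_eq_square)
    finally show ?thesis .
  qed
  have comp_\<sigma>: "comp u k (\<sigma> s x) = unit_root p (k * s) * comp u k x" if "x \<in> X" for u k s x
  proof -
    have "comp u k (\<sigma> s x) =
        (\<Sum>t\<in>?P. unit_root p (k * s) * (unit_root p (- (k * ((t + s) mod int p))) * of_real (u (\<sigma> ((t + s) mod int p) x))))"
    proof -
      have shift: "unit_root p (- (k * t)) = unit_root p (k * s) * unit_root p (- (k * ((t + s) mod int p)))" for t
      proof -
        have "[- (k * t) = k * s + - (k * ((t + s) mod int p))] (mod int p)"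
        proof -
          have "- (k * t) - (k * s + - (k * ((t + s) mod int p))) = - (k * ((t + s) - (t + s) mod int p))"
            by (simp add: algebra_simps)
          moreover have "int p dvd - (k * ((t + s) - (t + s) mod int p))"
            by (intro dvd_minus_iff[THEN iffD2] dvd_mult dvd_minus_mod)
          ultimately show ?thesis unfolding cong_iff_dvd_diff by (simp only:)
        qed
        then show ?thesis unfolding unit_root_add[symmetric] by (rule unit_root_cong[OF p_pos])
      qed
      show ?thesis unfolding comp_def
        by (intro sum.cong refl, subst shift) (simp only: \<sigma>_add[OF that] \<sigma>_mod[OF that] mult.assoc)
    qed
    also have "\<dots> = unit_root p (k * s) * comp u k x"
      unfolding comp_def sum_distrib_left[symmetric]
      by (subst sum_shift_mod[OF p_pos, of "\<lambda>t. unit_root p (- (k * t)) * of_real (u (\<sigma> t x))"]) simp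
    finally show ?thesis .
  qed
  have comp_g: "comp g k x = (\<Sum>y\<in>X. of_real (B x y) * comp v k y)" if x: "x \<in> X" for k x
  proof -
    have "g (\<sigma> t x) = (\<Sum>y\<in>X. B x y * v (\<sigma> t y))" for t
    proof -
      have "g (\<sigma> t x) = (\<Sum>y\<in>X. B (\<sigma> t x) (\<sigma> t y) * v (\<sigma> t y))"
        unfolding g_def by (rule sum_\<sigma>[symmetric])
      then show ?thesis using x by (simp add: B_\<sigma>)
    qed
    then have "comp g k x = (\<Sum>t\<in>?P. \<Sum>y\<in>X. of_real (B x y) * (unit_root p (- (k * t)) * of_real (v (\<sigma> t y))))"
      by (simp add: comp_def sum_distrib_left mult_ac)
    then show ?thesis
      unfolding comp_def by (subst (asm) sum.swap) (simp add: sum_distrib_left)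
  qed
  have each: "real (p - 1) * (\<Sum>x\<in>X. (cmod (comp g k x))\<^sup>2) \<le> F * (\<Sum>x\<in>X. (cmod (comp v k x))\<^sup>2)"
    if "k \<in> ?P" for k
  proof (cases "k = 0")
    case True
    have "comp v k y = 0" if "y \<in> X" for y
      unfolding comp_def True using v[OF that] by (simp flip: of_real_sum)
    then show ?thesis by (simp add: comp_g)
  next
    case False
    then have "\<not> int p dvd k" using that zdvd_imp_le[of "int p" k] by auto
    from character_component_bound[OF this comp_\<sigma>[of _ v]] show ?thesis
      by (simp add: F_def comp_g)
  qed
  have "real (p - 1) * ((real p)\<^sup>2 * (\<Sum>x\<in>X. (g x)\<^sup>2)) \<le> F * ((real p)\<^sup>2 * (\<Sum>x\<in>X. (v x)\<^sup>2))"
    using sum_mono[of ?P "\<lambda>k. real (p - 1) * (\<Sum>x\<in>X. (cmod (comp g k x))\<^sup>2)", OF each]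
    by (simp only: plancherel flip: sum_distrib_left)
  then have "(real p)\<^sup>2 * (real (p - 1) * (\<Sum>x\<in>X. (g x)\<^sup>2)) \<le> (real p)\<^sup>2 * (F * (\<Sum>x\<in>X. (v x)\<^sup>2))"
    by (simp add: mult_ac)
  then have "real (p - 1) * (\<Sum>x\<in>X. (g x)\<^sup>2) \<le> F * (\<Sum>x\<in>X. (v x)\<^sup>2)"
    using p_pos by (simp only: mult_le_cancel_left_pos zero_less_power of_nat_0_less_iff)
  then show ?thesis by (simp add: g_def F_def)
qed

definition mulB :: "('x \<Rightarrow> real) \<Rightarrow> 'x \<Rightarrow> real" where
  "mulB v x = (\<Sum>y\<in>X. B x y * v y)"

definition sqn :: "('x \<Rightarrow> real) \<Rightarrow> real" where
  "sqn v = (\<Sum>x\<in>X. (v x)\<^sup>2)"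

definition frob :: real where
  "frob = (\<Sum>x\<in>X. \<Sum>y\<in>X. (B x y)\<^sup>2)"

definition avg :: "('x \<Rightarrow> real) \<Rightarrow> 'x \<Rightarrow> real" where
  "avg v x = (\<Sum>t\<in>{0..<int p}. v (\<sigma> t x)) / real p"

lemma sqn_nonneg: "sqn v \<ge> 0"
  by (simp add: sqn_def sum_nonneg)

lemma frob_nonneg: "frob \<ge> 0"
  by (simp add: frob_def sum_nonneg)

lemma sqn_cong: "(\<And>x. x \<in> X \<Longrightarrow> u x = v x) \<Longrightarrow> sqn u = sqn v"
  by (simp add: sqn_def)

lemma avg_\<sigma>: "x \<in> X \<Longrightarrow> avg v (\<sigma> t x) = avg v x"
  by (simp add: avg_def sum_\<sigma>_shift)

lemma sum_avg: "(\<Sum>x\<in>X. avg v x) = (\<Sum>x\<in>X. v x)"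
proof -
  have "(\<Sum>x\<in>X. avg v x) = (\<Sum>t\<in>{0..<int p}. \<Sum>x\<in>X. v (\<sigma> t x)) / real p"
    unfolding avg_def sum_divide_distrib[symmetric] by (subst sum.swap) simp
  then show ?thesis using p_pos by (simp add: sum_\<sigma>)
qed

lemma avg_idem: "x \<in> X \<Longrightarrow> (\<Sum>t\<in>{0..<int p}. v (\<sigma> t x) - avg v (\<sigma> t x)) = 0"
  using p_pos by (simp add: avg_\<sigma> sum_subtractf) (simp add: avg_def)

text \<open>\<open>avg\<close> is the orthogonal projection onto the translation invariant
  functions: when the product of \<open>avg v\<close> and v is averaged, the invariant factor comes
  out.\<close>

lemma sqn_avg: "sqn v = sqn (avg v) + sqn (\<lambda>x. v x - avg v x)"
proof -
  have "(\<Sum>x\<in>X. avg v x * v x) = (\<Sum>x\<in>X. avg (\<lambda>x. avg v x * v x) x)"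
    by (rule sum_avg[symmetric])
  also have "\<dots> = (\<Sum>x\<in>X. avg v x * avg v x)"
    by (intro sum.cong refl)
       (simp add: avg_def[of "\<lambda>x. avg v x * v x"] avg_\<sigma> flip: sum_distrib_left, simp add: avg_def)
  finally have "(\<Sum>x\<in>X. avg v x * (v x - avg v x)) = 0"
    by (simp add: right_diff_distrib sum_subtractf)
  moreover have "sqn v = sqn (avg v) + sqn (\<lambda>x. v x - avg v x)
      + 2 * (\<Sum>x\<in>X. avg v x * (v x - avg v x))"
    unfolding sqn_def sum_distrib_left sum.distrib[symmetric]
    by (intro sum.cong refl) (simp add: power2_eq_square algebra_simps)
  ultimately show ?thesis by simp
qed

lemma mulB_avg:
  assumes x: "x \<in> X"
  shows "mulB (avg v) x = avg (mulB v) x"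
proof -
  have "mulB v (\<sigma> t x) = (\<Sum>y\<in>X. B x y * v (\<sigma> t y))" for t
  proof -
    have "mulB v (\<sigma> t x) = (\<Sum>y\<in>X. B (\<sigma> t x) (\<sigma> t y) * v (\<sigma> t y))"
      unfolding mulB_def by (rule sum_\<sigma>[symmetric])
    then show ?thesis using x by (simp add: B_\<sigma>)
  qed
  then have "avg (mulB v) x = (\<Sum>y\<in>X. \<Sum>t\<in>{0..<int p}. B x y * v (\<sigma> t y)) / real p"
    unfolding avg_def by (subst sum.swap) simp
  then show ?thesis
    by (simp add: mulB_def avg_def sum_divide_distrib sum_distrib_left)
qed

lemma mulB_diff: "mulB (\<lambda>x. u x - v x) x = mulB u x - mulB v x"
  by (simp add: mulB_def right_diff_distrib sum_subtractf)

text \<open>B commutes with \<open>avg\<close>, so the images of the two parts of v are again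
  orthogonal; the factor p - 1 is gained on the part with vanishing averages.\<close>

lemma sqn_mulB_le_avg:
  "real (p - 1) * sqn (mulB v) \<le> real (p - 1) * sqn (mulB (avg v)) + frob * (sqn v - sqn (avg v))"
proof -
  have "sqn (mulB v) = sqn (avg (mulB v)) + sqn (\<lambda>x. mulB v x - avg (mulB v) x)"
    by (rule sqn_avg)
  also have "sqn (avg (mulB v)) = sqn (mulB (avg v))"
    by (rule sqn_cong) (simp add: mulB_avg)
  also have "sqn (\<lambda>x. mulB v x - avg (mulB v) x) = sqn (mulB (\<lambda>x. v x - avg v x))"
    by (rule sqn_cong) (simp add: mulB_avg mulB_diff)
  finally have "sqn (mulB v) = sqn (mulB (avg v)) + sqn (mulB (\<lambda>x. v x - avg v x))" .
  moreover have "real (p - 1) * sqn (mulB (\<lambda>x. v x - avg v x)) \<le> frob * sqn (\<lambda>x. v x - avg v x)"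
    unfolding sqn_def mulB_def frob_def by (rule mean_zero_bound) (rule avg_idem)
  ultimately show ?thesis using sqn_avg[of v] by (simp add: distrib_left)
qed

lemma sqn_mulB_le_frob: "sqn (mulB v) \<le> frob * sqn v"
proof -
  have "(mulB v x)\<^sup>2 \<le> (\<Sum>y\<in>X. (B x y)\<^sup>2) * sqn v" for x
    unfolding mulB_def sqn_def by (rule Cauchy_Schwarz_ineq_sum)
  then show ?thesis
    unfolding frob_def sqn_def[of "mulB v"] by (simp add: sum_distrib_right sum_mono)
qed

text \<open>A symmetry \<open>\<iota>\<close> outside the affine group moves mass from the translation invariant
  functions, where the multiplicity argument is void, to their orthogonal complement.
  Any contraction rate \<open>\<theta> < 1\<close>, however close to 1, gives the same bound.\<close>

lemma contraction_bound:
  fixes Q :: "('x \<Rightarrow> real) \<Rightarrow> bool" and \<theta> :: real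
  assumes bij: "bij_betw \<iota> X X"
    and B_\<iota>: "\<And>x y. x \<in> X \<Longrightarrow> y \<in> X \<Longrightarrow> B (\<iota> x) (\<iota> y) = B x y"
    and closed: "\<And>v. Q v \<Longrightarrow> Q (avg (\<lambda>x. v (\<iota> x)))"
    and contr: "\<And>v. Q v \<Longrightarrow> sqn (avg (\<lambda>x. v (\<iota> x))) \<le> \<theta> * sqn v"
    and \<theta>: "0 \<le> \<theta>" "\<theta> < 1" and v: "Q v"
  shows "real (p - 1) * sqn (mulB v) \<le> frob * sqn v"
proof -
  \<comment> \<open>The crude bound by the Frobenius norm starts the iteration with the excess (p -
    1) \<open>frob\<close> over the target; each round multiplies this excess by \<theta>.\<close>
  have step: "real (p - 1) * sqn (mulB v) \<le> (frob + \<theta> ^ n * (real (p - 1) * frob)) * sqn v"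
    if "Q v" for n v
    using that
  proof (induction n arbitrary: v)
    case 0
    have "real (p - 1) * sqn (mulB v) \<le> real (p - 1) * (frob * sqn v)"
      by (intro mult_left_mono sqn_mulB_le_frob) simp
    moreover have "0 \<le> frob * sqn v" by (simp add: frob_nonneg sqn_nonneg)
    ultimately show ?case by (simp add: algebra_simps)
  next
    case (Suc n)
    define u where "u = (\<lambda>x. v (\<iota> x))"
    define C where "C = \<theta> ^ n * (real (p - 1) * frob)"
    have C: "C \<ge> 0" using \<theta> by (simp add: C_def frob_nonneg)
    have sum_\<iota>: "(\<Sum>x\<in>X. F (\<iota> x)) = (\<Sum>x\<in>X. F x)" for F :: "'x \<Rightarrow> real"
      using bij by (rule sum.reindex_bij_betw)
    have \<iota>_in: "x \<in> X \<Longrightarrow> \<iota> x \<in> X" for x using bij by (rule bij_betw_apply)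
    have "mulB u x = mulB v (\<iota> x)" if "x \<in> X" for x
    proof -
      have "mulB u x = (\<Sum>y\<in>X. B (\<iota> x) (\<iota> y) * v (\<iota> y))"
        using that by (simp add: mulB_def u_def B_\<iota>)
      then show ?thesis by (simp add: mulB_def sum_\<iota>[of "\<lambda>y. B (\<iota> x) y * v y"])
    qed
    then have Bu: "sqn (mulB u) = sqn (mulB v)"
      by (simp add: sqn_def sum_\<iota>[of "\<lambda>x. (mulB v x)\<^sup>2"])
    have u: "sqn u = sqn v" by (simp add: sqn_def u_def sum_\<iota>[of "\<lambda>x. (v x)\<^sup>2"])
    have "real (p - 1) * sqn (mulB v) \<le> real (p - 1) * sqn (mulB (avg u)) + frob * (sqn v - sqn (avg u))"
      using sqn_mulB_le_avg[of u] by (simp add: Bu u)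
    also have "\<dots> \<le> (frob + C) * sqn (avg u) + frob * (sqn v - sqn (avg u))"
      using Suc.IH[OF closed[OF Suc.prems]] by (simp add: u_def C_def)
    \<comment> \<open>The norm removed by averaging is paid for at the target rate, so only the
      excess C is weighted with the smaller norm of \<open>avg u\<close>.\<close>
    also have "\<dots> = frob * sqn v + C * sqn (avg u)" by (simp add: algebra_simps)
    also have "\<dots> \<le> frob * sqn v + C * (\<theta> * sqn v)"
      using contr[OF Suc.prems] C by (intro add_left_mono mult_left_mono) (simp_all add: u_def)
    finally show ?case by (simp add: C_def algebra_simps)
  qed
  have "(\<lambda>n. (frob + \<theta> ^ n * (real (p - 1) * frob)) * sqn v) \<longlonglongrightarrow> (frob + 0 * (real (p - 1) * frob)) * sqn v"
    using \<theta> by (intro tendsto_intros LIMSEQ_power_zero) simp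
  then show ?thesis
    using step[OF v] by (intro LIMSEQ_le_const[of _ "frob * sqn v"]) auto
qed

end

section \<open>The Legendre symbol on the projective line\<close>

lemma Legendre_cong:
  assumes "[a = b] (mod q)"
  shows "Legendre a q = Legendre b q"
proof -
  have "[a = 0] (mod q) \<longleftrightarrow> [b = 0] (mod q)"
    using assms by (simp add: cong_def)
  moreover have "QuadRes q a \<longleftrightarrow> QuadRes q b"
    unfolding QuadRes_def using assms by (simp add: cong_def)
  ultimately show ?thesis by (simp add: Legendre_def)
qed

lemma Legendre_eqI:
  fixes p :: nat
  assumes "2 < p" "[s = t] (mod int p)" "s \<in> {-1, 0, 1}" "t \<in> {-1, 0, 1}"
  shows "s = t"
proof (rule ccontr)
  assume "s \<noteq> t"
  have "int p dvd \<bar>s - t\<bar>" using assms(2) by (simp add: cong_iff_dvd_diff)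
  moreover have "\<bar>s - t\<bar> \<in> {1, 2}" using assms(3,4) \<open>s \<noteq> t\<close> by auto
  ultimately have "int p \<le> \<bar>s - t\<bar>" by (intro zdvd_imp_le) auto
  with \<open>\<bar>s - t\<bar> \<in> {1, 2}\<close> show False using assms(1) by auto
qed

lemma Legendre_values: "Legendre a q \<in> {-1, 0, 1}"
  by (simp add: Legendre_def)

lemma Legendre_mult:
  fixes p :: nat
  assumes "prime p" "2 < p"
  shows "Legendre (a * b) (int p) = Legendre a (int p) * Legendre b (int p)"
proof (rule Legendre_eqI[OF assms(2)])
  note euler = euler_criterion[OF assms]
  have "[Legendre (a * b) (int p) = a ^ ((p - 1) div 2) * b ^ ((p - 1) div 2)] (mod int p)"
    using euler[of "a * b"] by (simp add: power_mult_distrib)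
  moreover have "[Legendre a (int p) * Legendre b (int p) = a ^ ((p - 1) div 2) * b ^ ((p - 1) div 2)] (mod int p)"
    by (intro cong_mult euler)
  ultimately show "[Legendre (a * b) (int p) = Legendre a (int p) * Legendre b (int p)] (mod int p)"
    by (simp only: cong_def)
  show "Legendre a (int p) * Legendre b (int p) \<in> {-1, 0, 1}"
    using Legendre_values[of a "int p"] Legendre_values[of b "int p"] by auto
qed (rule Legendre_values)

lemma Legendre_minus_one:
  fixes p :: nat
  assumes "prime p" "p mod 4 = 1"
  shows "Legendre (-1) (int p) = 1"
proof (rule Legendre_eqI)
  have "p \<noteq> 2" "p \<ge> 2" using assms prime_ge_2_nat by auto
  then show p2: "2 < p" by simp
  have "(p - 1) div 2 = 2 * (p div 4)" using assms(2) by presburger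
  then show "[Legendre (-1) (int p) = 1] (mod int p)"
    using euler_criterion[OF assms(1) p2, of "-1"] by simp
qed (use Legendre_values in auto)

text \<open>If every nonzero residue were a square, Euler's criterion would make all p - 1 of them
  roots of x^((p - 1)/2) - 1 modulo p.\<close>

lemma exists_nonresidue:
  fixes p :: nat
  assumes p: "prime p" "2 < p"
  shows "\<exists>g. Legendre g (int p) = -1"
proof (rule ccontr)
  assume none: "\<nexists>g. Legendre g (int p) = -1"
  define h where "h = (p - 1) div 2"
  let ?R = "monom 1 h - 1 :: int poly"
  have h: "0 < h" "h < p - 1" using p by (auto simp: h_def)
  have deg: "degree ?R \<le> h"
    by (intro degree_diff_le) (auto simp: degree_monom_eq)
  have "coeff ?R h = 1" using h by simp
  then have "\<not> int p dvd coeff ?R h" using p by simp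
  then have R: "\<not> [:int p:] dvd ?R" unfolding const_poly_dvd_iff by blast
  have "1 * card {1..<int p} \<le> degree ?R"
  proof (rule card_multiple_roots_mod_le_degree[OF p(1) _ _ _ R])
    fix a :: int and k :: nat assume a: "a \<in> {1..<int p}" and k: "k < 1"
    have "\<not> int p dvd a" using a zdvd_imp_le[of "int p" a] by auto
    then have "Legendre a (int p) \<noteq> 0" by (auto simp: Legendre_def cong_0_iff)
    then have "Legendre a (int p) = 1" using none Legendre_values[of a "int p"] by auto
    then have "[1 = a ^ h] (mod int p)" using euler_criterion[OF p, of a] by (simp add: h_def)
    then show "int p dvd poly ((pderiv ^^ k) ?R) a"
      using k by (simp add: poly_monom cong_iff_dvd_diff dvd_diff_commute)
  qed (use p in auto)
  then show False using deg h by simp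
qed

locale paley_prime =
  fixes p :: nat
  assumes p: "prime p" and p_mod_4: "p mod 4 = 1"
begin

lemma p_ge: "p \<ge> 5"
  using p_mod_4 prime_ge_2_nat[OF p] by presburger

abbreviation F :: "int set" where "F \<equiv> {0..<int p}"

definition chi :: "int \<Rightarrow> real" where "chi a = of_int (Legendre a (int p))"

lemma chi_cong: "[a = b] (mod int p) \<Longrightarrow> chi a = chi b"
  by (simp add: chi_def Legendre_cong)

lemma chi_mult: "chi (a * b) = chi a * chi b"
  using p p_ge by (simp add: chi_def Legendre_mult)

lemma chi_uminus: "chi (- a) = chi a"
  using chi_mult[of "-1" a] Legendre_minus_one[OF p p_mod_4] by (simp add: chi_def)

lemma chi_diff_commute: "chi (a - b) = chi (b - a)"
  using chi_uminus[of "a - b"] by simp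

lemma chi_0: "int p dvd a \<Longrightarrow> chi a = 0"
  by (simp add: chi_def Legendre_def cong_0_iff)

lemma chi_square: "\<not> int p dvd a \<Longrightarrow> (chi a)\<^sup>2 = 1"
  by (simp add: chi_def Legendre_def cong_0_iff)

lemma chi_square_le: "(chi a)\<^sup>2 \<le> 1"
  by (simp add: chi_def Legendre_def)

lemma not_dvd_F: "a \<in> F \<Longrightarrow> a \<noteq> 0 \<Longrightarrow> \<not> int p dvd a"
  using zdvd_imp_le[of "int p" a] by auto

lemma mod_in_F: "a mod int p \<in> F"
  using p_ge by simp

section \<open>Inverses modulo p and complete character sums\<close>

definition minv :: "int \<Rightarrow> int" where "minv a = a ^ (p - 2) mod int p"

lemma minv_mult: "\<not> int p dvd a \<Longrightarrow> [a * minv a = 1] (mod int p)"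
proof -
  assume a: "\<not> int p dvd a"
  define b where "b = nat (a mod int p)"
  have ab: "[a = int b] (mod int p)" using p_ge by (simp add: b_def cong_def)
  have "\<not> int p dvd int b" using a cong_dvd_iff[OF ab] by simp
  then have "\<not> p dvd b" by simp
  then have "[b ^ (p - 1) = 1] (mod p)" using p by (intro fermat_theorem)
  then have "[int b ^ (p - 1) = 1] (mod int p)"
    by (metis cong_int_iff of_nat_1 of_nat_power)
  then have "[a ^ (p - 1) = 1] (mod int p)"
    using cong_pow[OF ab, of "p - 1"] by (simp only: cong_def)
  moreover have "a * a ^ (p - 2) = a ^ (p - 1)"
  proof -
    have "p - 1 = Suc (p - 2)" using p_ge by simp
    then show ?thesis by (simp only: power_Suc)
  qed
  ultimately show ?thesis by (simp add: minv_def cong_def mod_mult_right_eq)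
qed

lemma minv_in_F: "minv a \<in> F"
  unfolding minv_def by (rule mod_in_F)

lemma minv_not_dvd: "\<not> int p dvd a \<Longrightarrow> \<not> int p dvd minv a"
proof
  assume "\<not> int p dvd a" "int p dvd minv a"
  then have "int p dvd a * minv a" "[a * minv a = 1] (mod int p)"
    using minv_mult by auto
  then have "int p dvd 1" using cong_dvd_iff by blast
  then show False using p_ge by simp
qed

lemma minv_minv:
  assumes "a \<in> F" "a \<noteq> 0"
  shows "minv (minv a) = a"
proof -
  have a: "\<not> int p dvd a" using assms by (rule not_dvd_F)
  have "[a * (minv a * minv (minv a)) = a * 1] (mod int p)"
    by (intro cong_mult cong_refl minv_mult minv_not_dvd a)
  moreover have "[(a * minv a) * minv (minv a) = 1 * minv (minv a)] (mod int p)"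
    by (intro cong_mult cong_refl minv_mult a)
  ultimately have "[minv (minv a) = a] (mod int p)"
    by (simp add: cong_def mult.assoc)
  then show ?thesis
    using assms minv_in_F[of "minv a"] by (simp add: cong_def)
qed

text \<open>Multiplication by a nonresidue permutes the residues and changes the sign of every
  term.\<close>

lemma sum_chi: "(\<Sum>a\<in>F. chi a) = 0"
proof -
  obtain g where g: "Legendre g (int p) = -1"
    using exists_nonresidue p p_ge by fastforce
  then have ng: "\<not> int p dvd g" by (auto simp: Legendre_def cong_0_iff)
  have inv: "(g * (minv g * a mod int p)) mod int p = a" "(minv g * (g * a mod int p)) mod int p = a"
    if "a \<in> F" for a
  proof -
    have "[(g * minv g) * a = 1 * a] (mod int p)"
      by (intro cong_mult minv_mult ng cong_refl)
    then have "(g * minv g * a) mod int p = a" using that by (simp add: cong_def)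
    then show "(g * (minv g * a mod int p)) mod int p = a" "(minv g * (g * a mod int p)) mod int p = a"
      by (simp_all add: mod_simps mult_ac)
  qed
  have "(\<Sum>a\<in>F. chi (g * a mod int p)) = (\<Sum>a\<in>F. chi a)"
    by (rule sum.reindex_bij_witness[of _ "\<lambda>a. minv g * a mod int p" "\<lambda>a. g * a mod int p"])
       (use inv mod_in_F in auto)
  moreover have "chi (g * a mod int p) = - chi a" for a
  proof -
    have "chi (g * a mod int p) = chi (g * a)" by (rule chi_cong) (simp add: cong_def)
    then show ?thesis using g by (simp add: chi_mult) (simp add: chi_def)
  qed
  ultimately show ?thesis by (simp add: sum_negf)
qed

lemma sum_chi_shift: "(\<Sum>a\<in>F. chi (b - a)) = 0"
proof -
  have "(\<Sum>a\<in>F. chi (b - a)) = (\<Sum>a\<in>F. chi ((a + (- b)) mod int p))"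
    by (intro sum.cong refl) (subst chi_diff_commute, rule chi_cong, simp add: cong_def)
  also have "\<dots> = 0" using sum_shift_mod[of p chi "- b"] p_ge sum_chi by simp
  finally show ?thesis .
qed

lemma cubic_chi_sum: "(\<Sum>e\<in>F. chi (b - e) * chi (c - e) * chi (d - e))\<^sup>2 \<le> 1000 * real p"
proof -
  let ?f = "[:-b, 1:] * [:-c, 1:] * [:-d, 1:] :: int poly"
  have "odd p" using p_mod_4 by presburger
  moreover have "degree ?f = 3" by (simp add: degree_mult_eq del: mult_pCons_left mult_pCons_right)
  moreover have "lead_coeff ?f = 1" by (simp only: lead_coeff_mult) simp
  ultimately have "(\<Sum>e\<in>F. Legendre (poly ?f e) (int p))\<^sup>2 \<le> 1000 * int p"
    using cubic_Legendre_sum_bound[OF p] by blast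
  then have "real_of_int ((\<Sum>e\<in>F. Legendre (poly ?f e) (int p))\<^sup>2) \<le> real_of_int (1000 * int p)"
    by (simp only: of_int_le_iff)
  then have "(\<Sum>e\<in>F. chi (poly ?f e))\<^sup>2 \<le> 1000 * real p"
    by (simp add: chi_def)
  moreover have "poly ?f e = (e - b) * (e - c) * (e - d)" for e by (simp add: algebra_simps)
  then have "chi (poly ?f e) = chi (b - e) * chi (c - e) * chi (d - e)" for e
    by (simp only: chi_mult chi_diff_commute[of e])
  ultimately show ?thesis by simp
qed

text \<open>Here \<open>None\<close> is the point at infinity.\<close>

definition P1 :: "int option set" where "P1 = insert None (Some ` F)"

lemma finite_P1: "finite P1"
  by (simp add: P1_def)

lemma sum_P1: "(\<Sum>x\<in>P1. f x) = f None + (\<Sum>a\<in>F. f (Some a))"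
  by (simp add: P1_def sum.reindex image_iff)

lemma card_P1: "card P1 = p + 1"
  by (simp add: P1_def card_image image_iff)

text \<open>This is chi of the determinant of the representatives (a, 1) of \<open>Some a\<close>
  and (1, 0) of \<open>None\<close>; the order of the two is immaterial as chi(-1) = 1. Rescaling
  the representative of a point multiplies all its values by one sign, which is the freedom recorded
  by c in \<open>\<kappa>_moebius\<close>.\<close>

fun \<kappa> :: "int option \<Rightarrow> int option \<Rightarrow> real" where
  "\<kappa> None None = 0"
| "\<kappa> None (Some b) = 1"
| "\<kappa> (Some a) None = 1"
| "\<kappa> (Some a) (Some b) = chi (a - b)"

lemma \<kappa>_commute: "\<kappa> x y = \<kappa> y x"
  by (cases x; cases y) (simp_all add: chi_diff_commute)

lemma \<kappa>_same [simp]: "\<kappa> x x = 0"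
  by (cases x) (simp_all add: chi_0)

lemma \<kappa>_square: "x \<in> P1 \<Longrightarrow> y \<in> P1 \<Longrightarrow> x \<noteq> y \<Longrightarrow> (\<kappa> x y)\<^sup>2 = 1"
  by (cases x; cases y) (auto simp: P1_def image_iff residue_dvd_diff_iff intro!: chi_square)

lemma \<kappa>_square_le: "(\<kappa> x y)\<^sup>2 \<le> 1"
  by (cases x; cases y) (simp_all add: chi_square_le)

text \<open>A Moebius transformation \<open>g\<close> with determinant \<open>\<Delta>\<close> and denominator \<open>\<gamma> x + \<eta>\<close> satisfies
  \<open>g x - g y = \<Delta> (x - y) / ((\<gamma> x + \<eta>) (\<gamma> y + \<eta>))\<close>; this is what remains of it after
  applying \<open>chi\<close>.\<close>

definition \<kappa>_moebius :: "(int option \<Rightarrow> int option) \<Rightarrow> bool" where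
  "\<kappa>_moebius g \<longleftrightarrow> bij_betw g P1 P1 \<and> (\<exists>d c. d\<^sup>2 = 1 \<and> (\<forall>x\<in>P1. (c x)\<^sup>2 = 1) \<and>
    (\<forall>x\<in>P1. \<forall>y\<in>P1. \<kappa> (g x) (g y) = d * c x * c y * \<kappa> x y))"

lemma \<kappa>_moebiusI:
  fixes d :: real
  assumes "\<And>x. x \<in> P1 \<Longrightarrow> g x \<in> P1" "\<And>x. x \<in> P1 \<Longrightarrow> g' x \<in> P1"
    and "\<And>x. x \<in> P1 \<Longrightarrow> g' (g x) = x" "\<And>x. x \<in> P1 \<Longrightarrow> g (g' x) = x"
    and "d\<^sup>2 = 1" "\<And>x. x \<in> P1 \<Longrightarrow> (c x)\<^sup>2 = 1"
    and "\<And>x y. x \<in> P1 \<Longrightarrow> y \<in> P1 \<Longrightarrow> x \<noteq> y \<Longrightarrow> \<kappa> (g x) (g y) = d * c x * c y * \<kappa> x y"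
  shows "\<kappa>_moebius g"
proof -
  have "bij_betw g P1 P1"
    by (rule bij_betw_byWitness[of _ g']) (use assms in auto)
  moreover have "\<kappa> (g x) (g y) = d * c x * c y * \<kappa> x y" if "x \<in> P1" "y \<in> P1" for x y
    using assms(7)[OF that] by (cases "x = y") auto
  ultimately show ?thesis using assms(5,6) unfolding \<kappa>_moebius_def by blast
qed

lemma \<kappa>_moebius_comp:
  assumes f: "\<kappa>_moebius f" and g: "\<kappa>_moebius g"
  shows "\<kappa>_moebius (f \<circ> g)"
proof -
  obtain d c where dc: "d\<^sup>2 = 1" "\<forall>x\<in>P1. (c x)\<^sup>2 = 1"
      "\<forall>x\<in>P1. \<forall>y\<in>P1. \<kappa> (f x) (f y) = d * c x * c y * \<kappa> x y"
    using f unfolding \<kappa>_moebius_def by blast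
  obtain d' c' where dc': "d'\<^sup>2 = 1" "\<forall>x\<in>P1. (c' x)\<^sup>2 = 1"
      "\<forall>x\<in>P1. \<forall>y\<in>P1. \<kappa> (g x) (g y) = d' * c' x * c' y * \<kappa> x y"
    using g unfolding \<kappa>_moebius_def by blast
  have bij: "bij_betw f P1 P1" "bij_betw g P1 P1" using f g by (auto simp: \<kappa>_moebius_def)
  have gin: "x \<in> P1 \<Longrightarrow> g x \<in> P1" for x using bij(2) by (rule bij_betw_apply)
  have "bij_betw (f \<circ> g) P1 P1" using bij by (simp add: bij_betw_trans)
  moreover have "(d * d')\<^sup>2 = 1" using dc dc' by (simp add: power_mult_distrib)
  moreover have "(c (g x) * c' x)\<^sup>2 = 1" if "x \<in> P1" for x
    using that dc dc' gin by (simp add: power_mult_distrib)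
  moreover have "\<kappa> ((f \<circ> g) x) ((f \<circ> g) y) =
      (d * d') * (c (g x) * c' x) * (c (g y) * c' y) * \<kappa> x y" if "x \<in> P1" "y \<in> P1" for x y
    using that dc(3) dc'(3) gin by (simp add: mult_ac)
  ultimately show ?thesis unfolding \<kappa>_moebius_def
    by (intro conjI exI[of _ "d * d'"] exI[of _ "\<lambda>x. c (g x) * c' x"]) auto
qed

section \<open>Generators of the projective linear group\<close>

definition shift :: "int \<Rightarrow> int option \<Rightarrow> int option" where
  "shift t = map_option (\<lambda>a. (a + t) mod int p)"

definition dilate :: "int \<Rightarrow> int option \<Rightarrow> int option" where
  "dilate \<alpha> = map_option (\<lambda>a. \<alpha> * a mod int p)"

definition invert :: "int option \<Rightarrow> int option" where
  "invert x = (case x of None \<Rightarrow> Some 0 | Some a \<Rightarrow> if a = 0 then None else Some (minv a))"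

lemma shift_P1: "x \<in> P1 \<Longrightarrow> shift t x \<in> P1"
  using mod_in_F by (cases x) (auto simp: P1_def shift_def)

lemma shift_shift: "shift s (shift t x) = shift (s + t) x"
  by (cases x) (simp_all add: shift_def mod_simps algebra_simps)

lemma shift_mod: "shift (t mod int p) x = shift t x"
  by (cases x) (simp_all add: shift_def mod_simps)

lemma shift_0: "x \<in> P1 \<Longrightarrow> shift 0 x = x"
  by (cases x) (auto simp: shift_def P1_def)

lemma dilate_P1: "x \<in> P1 \<Longrightarrow> dilate \<alpha> x \<in> P1"
  using mod_in_F by (cases x) (auto simp: P1_def dilate_def)

lemma dilate_shift: "dilate \<alpha> (shift t x) = shift (\<alpha> * t) (dilate \<alpha> x)"
  by (cases x) (simp_all add: shift_def dilate_def mod_simps algebra_simps)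

lemma dilate_dilate_minv:
  assumes "\<not> int p dvd \<alpha>" "x \<in> P1"
  shows "dilate (minv \<alpha>) (dilate \<alpha> x) = x" "dilate \<alpha> (dilate (minv \<alpha>) x) = x"
proof -
  have "(\<alpha> * minv \<alpha> * a) mod int p = a" if "a \<in> F" for a
  proof -
    have "[(\<alpha> * minv \<alpha>) * a = 1 * a] (mod int p)"
      by (intro cong_mult minv_mult assms cong_refl)
    then show ?thesis using that by (simp add: cong_def)
  qed
  then show "dilate (minv \<alpha>) (dilate \<alpha> x) = x" "dilate \<alpha> (dilate (minv \<alpha>) x) = x"
    using assms(2) by (cases x; auto simp: P1_def dilate_def mod_simps mult_ac)+
qed

lemma \<kappa>_moebius_shift: "\<kappa>_moebius (shift t)"
proof (rule \<kappa>_moebiusI[of _ "shift (- t)" 1 "\<lambda>_. 1"])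
  fix x y assume "x \<in> P1" "y \<in> P1"
  show "\<kappa> (shift t x) (shift t y) = 1 * 1 * 1 * \<kappa> x y"
    by (cases x; cases y) (auto simp: shift_def cong_def mod_simps intro!: chi_cong)
qed (simp_all add: shift_P1 shift_shift shift_0)

text \<open>The symbol of a finite difference is multiplied by chi \<alpha>, while the values
  against \<open>None\<close> stay 1; the weight chi \<alpha> at \<open>None\<close> undoes the
  determinant there.\<close>

lemma \<kappa>_moebius_dilate:
  assumes \<alpha>: "\<not> int p dvd \<alpha>"
  shows "\<kappa>_moebius (dilate \<alpha>)"
proof (rule \<kappa>_moebiusI[of _ "dilate (minv \<alpha>)" "chi \<alpha>" "\<lambda>x. if x = None then chi \<alpha> else 1"])
  fix x y assume "x \<in> P1" "y \<in> P1" "x \<noteq> y"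
  have "chi (\<alpha> * a mod int p - \<alpha> * b mod int p) = chi \<alpha> * chi (a - b)" for a b
    unfolding chi_mult[symmetric]
    by (rule chi_cong) (simp add: cong_def mod_simps right_diff_distrib)
  then show "\<kappa> (dilate \<alpha> x) (dilate \<alpha> y) =
      chi \<alpha> * (if x = None then chi \<alpha> else 1) * (if y = None then chi \<alpha> else 1) * \<kappa> x y"
    using chi_square[OF \<alpha>] \<open>x \<noteq> y\<close>
    by (cases x; cases y) (simp_all add: dilate_def power2_eq_square)
qed (use \<alpha> in \<open>auto simp: dilate_P1 dilate_dilate_minv chi_square\<close>)

lemma minv_nonzero: "a \<in> F \<Longrightarrow> a \<noteq> 0 \<Longrightarrow> minv a \<noteq> 0"
  using minv_not_dvd[OF not_dvd_F, of a] by auto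

lemma invert_P1: "x \<in> P1 \<Longrightarrow> invert x \<in> P1"
  using minv_in_F p_ge by (cases x) (auto simp: P1_def invert_def)

lemma invert_invert: "x \<in> P1 \<Longrightarrow> invert (invert x) = x"
  using minv_nonzero[of "the x"] minv_minv[of "the x"]
  by (cases x; cases "the x = 0") (auto simp: P1_def invert_def)

text \<open>1/a - 1/b = (b - a)/(ab), multiplied out by ab; chi does not distinguish multiplication
  by ab from division by it.\<close>

lemma chi_minv_diff:
  assumes "\<not> int p dvd a" "\<not> int p dvd b"
  shows "chi (minv a - minv b) = chi a * chi b * chi (a - b)"
proof -
  have "[a * minv a * b - b * minv b * a = 1 * b - 1 * a] (mod int p)"
    by (intro cong_diff cong_mult minv_mult assms cong_refl)
  then have "chi (a * b * (minv a - minv b)) = chi (b - a)"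
    by (intro chi_cong) (simp add: algebra_simps)
  then have "chi a * chi b * (chi a * chi b * chi (minv a - minv b)) = chi a * chi b * chi (a - b)"
    by (simp add: chi_mult chi_diff_commute[of b])
  moreover have "chi a * chi b * (chi a * chi b * z) = (chi a)\<^sup>2 * (chi b)\<^sup>2 * z" for z
    by (simp add: power2_eq_square)
  ultimately show ?thesis using assms by (simp add: chi_square)
qed

lemma chi_minv: "\<not> int p dvd a \<Longrightarrow> chi (minv a) = chi a"
proof -
  assume a: "\<not> int p dvd a"
  have "chi (a * minv a) = chi 1" by (intro chi_cong minv_mult a)
  moreover have "chi (1 * 1) = chi 1 * chi 1" by (rule chi_mult)
  moreover have "(chi 1)\<^sup>2 = 1" using p_ge by (intro chi_square) simp
  ultimately have inv: "chi a * chi (minv a) = 1"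
    by (auto simp: chi_mult)
  have "chi (minv a) = (chi a)\<^sup>2 * chi (minv a)" using chi_square[OF a] by simp
  also have "\<dots> = chi a * (chi a * chi (minv a))" by (simp only: power2_eq_square mult.assoc)
  finally show ?thesis by (simp add: inv)
qed

text \<open>Swapping coordinates sends (a, 1) to a times (1/a, 1), whence the weight chi a; (0, 1)
  and (1, 0) are exchanged without scaling, whence the weight 1 at both. The determinant is -1, with
  symbol 1.\<close>

lemma \<kappa>_moebius_invert: "\<kappa>_moebius invert"
proof (rule \<kappa>_moebiusI[of _ invert 1 "\<lambda>x. case x of None \<Rightarrow> 1 | Some a \<Rightarrow> if a = 0 then 1 else chi a"])
  let ?c = "\<lambda>x. case x of None \<Rightarrow> 1 | Some a \<Rightarrow> if a = 0 then 1 else chi a"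
  fix x assume "x \<in> P1"
  then show "(?c x)\<^sup>2 = 1"
    by (cases x) (auto simp: P1_def not_dvd_F chi_square)
next
  let ?c = "\<lambda>x. case x of None \<Rightarrow> 1 | Some a \<Rightarrow> if a = 0 then 1 else chi a"
  fix x y assume "x \<in> P1" "y \<in> P1" "x \<noteq> y"
  moreover have "chi a * chi a = 1" "chi a * (chi a * z) = z" if "\<not> int p dvd a" for a z
    using chi_square[OF that] by (simp_all add: power2_eq_square flip: mult.assoc)
  ultimately show "\<kappa> (invert x) (invert y) = 1 * ?c x * ?c y * \<kappa> x y"
    by (cases x; cases y)
       (auto simp: P1_def invert_def not_dvd_F chi_minv_diff chi_uminus chi_minv)
qed (simp_all add: invert_P1 invert_invert)

lemma move_to_infinity:
  assumes "a \<in> P1"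
  shows "\<exists>g. \<kappa>_moebius g \<and> g a = None"
proof (cases a)
  case None
  then show ?thesis using \<kappa>_moebius_shift[of 0] by (auto simp: shift_def)
next
  case (Some x)
  have "(invert \<circ> shift (- x)) a = None" by (simp add: Some shift_def invert_def)
  then show ?thesis using \<kappa>_moebius_comp[OF \<kappa>_moebius_invert \<kappa>_moebius_shift] by blast
qed

end

section \<open>The extended matrix\<close>

context paley_prime
begin

text \<open>Ordered pairs, so that a map of points acts coordinatewise; unordered pairs return
  through \<open>swap_symmetric\<close> functions.\<close>

definition X :: "(int option \<times> int option) set" where
  "X = {P. fst P \<in> P1 \<and> snd P \<in> P1 \<and> fst P \<noteq> snd P}"

definition T :: "int option \<times> int option \<Rightarrow> int option \<times> int option \<Rightarrow> real" where
  "T P Q = \<kappa> (fst P) (fst Q) * \<kappa> (fst P) (snd Q) * \<kappa> (snd P) (fst Q) * \<kappa> (snd P) (snd Q)"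

definition B :: "int option \<times> int option \<Rightarrow> int option \<times> int option \<Rightarrow> real" where
  "B P Q = (\<Sum>R\<in>X. T P R * T R Q)"

lemma X_subset: "X \<subseteq> P1 \<times> P1"
  by (auto simp: X_def)

lemma finite_X: "finite X"
  using X_subset finite_P1 finite_subset by blast

lemma card_X_le: "card X \<le> (p + 1)\<^sup>2"
  using card_mono[OF _ X_subset] finite_P1 by (simp add: card_cartesian_product card_P1 power2_eq_square)

lemma sum_X: "(\<Sum>P\<in>X. f P) = (\<Sum>a\<in>P1. \<Sum>b\<in>P1 - {a}. f (a, b))"
proof -
  have "X = (SIGMA a:P1. P1 - {a})" by (auto simp: X_def)
  then show ?thesis using finite_P1 by (simp add: sum.Sigma)
qed

lemma sum_offdiag_product:
  fixes k :: "int option \<Rightarrow> real"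
  shows "(\<Sum>P\<in>X. k (fst P) * k (snd P)) = (\<Sum>e\<in>P1. k e)\<^sup>2 - (\<Sum>e\<in>P1. (k e)\<^sup>2)"
proof -
  have "(\<Sum>P\<in>X. k (fst P) * k (snd P)) = (\<Sum>e\<in>P1. k e * ((\<Sum>f\<in>P1. k f) - k e))"
    unfolding sum_X using finite_P1
    by (intro sum.cong refl) (simp add: sum_diff1 flip: sum_distrib_left)
  also have "\<dots> = (\<Sum>e\<in>P1. k e)\<^sup>2 - (\<Sum>e\<in>P1. (k e)\<^sup>2)"
    by (simp add: right_diff_distrib sum_subtractf power2_eq_square flip: sum_distrib_right)
  finally show ?thesis .
qed

lemma T_commute: "T P Q = T Q P"
  unfolding T_def
  by (subst (1 2 3 4) \<kappa>_commute) (simp add: mult_ac)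

text \<open>Each of the four points occurs in two factors and the determinant in four, so all signs
  of g square away; this is the invariance of the cross-ratio.\<close>

lemma T_moebius:
  assumes g: "\<kappa>_moebius g" and PQ: "P \<in> X" "Q \<in> X"
  shows "T (map_prod g g P) (map_prod g g Q) = T P Q"
proof -
  obtain d c where dc: "d\<^sup>2 = 1" "\<forall>x\<in>P1. (c x)\<^sup>2 = 1"
      "\<forall>x\<in>P1. \<forall>y\<in>P1. \<kappa> (g x) (g y) = d * c x * c y * \<kappa> x y"
    using g unfolding \<kappa>_moebius_def by blast
  have in_P1: "fst P \<in> P1" "snd P \<in> P1" "fst Q \<in> P1" "snd Q \<in> P1" using PQ by (auto simp: X_def)
  have "T (map_prod g g P) (map_prod g g Q) =
      (d\<^sup>2)\<^sup>2 * (c (fst P))\<^sup>2 * (c (snd P))\<^sup>2 * (c (fst Q))\<^sup>2 * (c (snd Q))\<^sup>2 * T P Q"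
    using in_P1 by (simp add: T_def dc(3) power2_eq_square)
  then show ?thesis using dc(1,2) in_P1 by simp
qed

lemma bij_betw_X:
  assumes "bij_betw g P1 P1"
  shows "bij_betw (map_prod g g) X X"
proof (rule bij_betw_imageI)
  have inj: "inj_on g P1" and img: "g ` P1 = P1" using assms by (auto simp: bij_betw_def)
  have g: "g x = g y \<longleftrightarrow> x = y" "g x \<in> P1" if "x \<in> P1" "y \<in> P1" for x y
    using that inj img by (auto simp: inj_on_eq_iff)
  show "inj_on (map_prod g g) X"
    using g by (intro inj_onI) (auto simp: X_def)
  show "map_prod g g ` X = X"
  proof
    show "map_prod g g ` X \<subseteq> X" using g by (auto simp: X_def)
    show "X \<subseteq> map_prod g g ` X"
    proof
      fix P assume P: "P \<in> X"
      then have "fst P \<in> g ` P1" "snd P \<in> g ` P1" using img by (auto simp: X_def)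
      then obtain a b where ab: "a \<in> P1" "b \<in> P1" "fst P = g a" "snd P = g b" by blast
      then have "(a, b) \<in> X" using P by (auto simp: X_def)
      moreover have "P = map_prod g g (a, b)" using ab by (simp add: prod_eq_iff)
      ultimately show "P \<in> map_prod g g ` X" by blast
    qed
  qed
qed

lemma bij_betw_X_moebius: "\<kappa>_moebius g \<Longrightarrow> bij_betw (map_prod g g) X X"
  by (rule bij_betw_X) (simp add: \<kappa>_moebius_def)

lemma B_moebius:
  assumes g: "\<kappa>_moebius g" and PQ: "P \<in> X" "Q \<in> X"
  shows "B (map_prod g g P) (map_prod g g Q) = B P Q"
proof -
  have "B (map_prod g g P) (map_prod g g Q) =
      (\<Sum>R\<in>X. T (map_prod g g P) (map_prod g g R) * T (map_prod g g R) (map_prod g g Q))"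
    unfolding B_def using bij_betw_X_moebius[OF g] by (rule sum.reindex_bij_betw[symmetric])
  also have "\<dots> = B P Q"
    unfolding B_def by (intro sum.cong refl) (simp add: T_moebius[OF g] PQ)
  finally show ?thesis .
qed

section \<open>Character sums on the projective line\<close>

lemma moebius_reindex:
  assumes "\<kappa>_moebius g"
  shows "(\<Sum>e\<in>P1. f (g e)) = (\<Sum>e\<in>P1. f e)"
  using assms by (intro sum.reindex_bij_betw) (simp add: \<kappa>_moebius_def)

text \<open>With a at infinity the sum becomes the complete linear sum of chi(b' - e), which is 0;
  the signs of a and b come out of the sum and those of e square away.\<close>

lemma quadratic_\<kappa>_sum:
  assumes ab: "a \<in> P1" "b \<in> P1" "a \<noteq> b"
  shows "(\<Sum>e\<in>P1. \<kappa> a e * \<kappa> b e) = 0"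
proof -
  obtain g where g: "\<kappa>_moebius g" "g a = None" using move_to_infinity[OF ab(1)] by blast
  obtain d c where dc: "d\<^sup>2 = 1" "\<forall>x\<in>P1. (c x)\<^sup>2 = 1"
      "\<forall>x\<in>P1. \<forall>y\<in>P1. \<kappa> (g x) (g y) = d * c x * c y * \<kappa> x y"
    using g unfolding \<kappa>_moebius_def by blast
  have "inj_on g P1" "g b \<in> P1" using g ab bij_betw_apply by (auto simp: \<kappa>_moebius_def bij_betw_def)
  then obtain b' where b': "g b = Some b'"
    using ab g(2) by (metis inj_onD option.exhaust)
  have "0 = (\<Sum>e\<in>P1. \<kappa> None e * \<kappa> (Some b') e)"
    by (simp add: sum_P1 sum_chi_shift)
  also have "\<dots> = (\<Sum>e\<in>P1. \<kappa> (g a) (g e) * \<kappa> (g b) (g e))"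
    unfolding g(2) b' by (rule moebius_reindex[OF g(1), symmetric])
  also have "\<dots> = (\<Sum>e\<in>P1. d\<^sup>2 * (c a * c b) * (c e)\<^sup>2 * (\<kappa> a e * \<kappa> b e))"
    using ab by (intro sum.cong refl) (simp add: dc(3) power2_eq_square)
  also have "\<dots> = (c a * c b) * (\<Sum>e\<in>P1. \<kappa> a e * \<kappa> b e)"
    using dc by (simp add: sum_distrib_left)
  finally have "(c a * c b) * (\<Sum>e\<in>P1. \<kappa> a e * \<kappa> b e) = 0" by simp
  moreover have "c a \<noteq> 0" "c b \<noteq> 0" using dc(2) ab by fastforce+
  ultimately show ?thesis by simp
qed

definition S :: "int option \<Rightarrow> int option \<Rightarrow> int option \<Rightarrow> int option \<Rightarrow> real" where
  "S a b c d = (\<Sum>e\<in>P1. \<kappa> a e * \<kappa> b e * \<kappa> c e * \<kappa> d e)"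

text \<open>The signs of e and of the determinant occur to the fourth power, those of a, b, c, d
  only once: S itself is invariant up to sign, hence the square.\<close>

lemma S_moebius:
  assumes g: "\<kappa>_moebius g" and abcd: "a \<in> P1" "b \<in> P1" "c \<in> P1" "d \<in> P1"
  shows "(S (g a) (g b) (g c) (g d))\<^sup>2 = (S a b c d)\<^sup>2"
proof -
  obtain D C where DC: "D\<^sup>2 = 1" "\<forall>x\<in>P1. (C x)\<^sup>2 = 1"
      "\<forall>x\<in>P1. \<forall>y\<in>P1. \<kappa> (g x) (g y) = D * C x * C y * \<kappa> x y"
    using g unfolding \<kappa>_moebius_def by blast
  have "S (g a) (g b) (g c) (g d) =
      (\<Sum>e\<in>P1. \<kappa> (g a) (g e) * \<kappa> (g b) (g e) * \<kappa> (g c) (g e) * \<kappa> (g d) (g e))"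
    unfolding S_def by (rule moebius_reindex[OF g, symmetric])
  also have "\<dots> = (\<Sum>e\<in>P1. (D\<^sup>2)\<^sup>2 * ((C e)\<^sup>2)\<^sup>2 * (C a * C b * C c * C d) * (\<kappa> a e * \<kappa> b e * \<kappa> c e * \<kappa> d e))"
    using abcd by (intro sum.cong refl) (simp add: DC(3) power2_eq_square)
  also have "\<dots> = (C a * C b * C c * C d) * S a b c d"
    using DC by (simp add: S_def sum_distrib_left)
  finally show ?thesis using DC abcd by (simp add: power_mult_distrib)
qed

text \<open>The doubled factor is 1 away from a, so S is the vanishing quadratic sum of b and d
  without its term at a.\<close>

lemma S_shared:
  assumes "a \<in> P1" "b \<in> P1" "d \<in> P1" "b \<noteq> d"
  shows "(S a b a d)\<^sup>2 \<le> 1"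
proof -
  have "S a b a d = (\<Sum>e\<in>P1 - {a}. \<kappa> b e * \<kappa> d e)"
  proof -
    have "S a b a d = (\<Sum>e\<in>P1. (\<kappa> a e)\<^sup>2 * (\<kappa> b e * \<kappa> d e))"
      by (simp add: S_def power2_eq_square mult_ac)
    also have "\<dots> = (\<Sum>e\<in>P1 - {a}. (\<kappa> a e)\<^sup>2 * (\<kappa> b e * \<kappa> d e))"
      using finite_P1 by (intro sum.mono_neutral_right) auto
    also have "\<dots> = (\<Sum>e\<in>P1 - {a}. \<kappa> b e * \<kappa> d e)"
      using assms by (intro sum.cong refl) (subst \<kappa>_square, auto)
    finally show ?thesis .
  qed
  also have "\<dots> = - (\<kappa> b a * \<kappa> d a)"
    using quadratic_\<kappa>_sum[OF assms(2-4)] finite_P1 assms by (simp add: sum_diff1)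
  finally have "(S a b a d)\<^sup>2 = (\<kappa> b a)\<^sup>2 * (\<kappa> d a)\<^sup>2" by (simp add: power_mult_distrib)
  also have "\<dots> \<le> 1 * 1" by (intro mult_mono \<kappa>_square_le) auto
  finally show ?thesis by simp
qed

lemma S_bound:
  assumes in_P1: "a \<in> P1" "b \<in> P1" "c \<in> P1" "d \<in> P1"
    and ne: "a \<noteq> b" "c \<noteq> d" "(c, d) \<noteq> (a, b)" "(c, d) \<noteq> (b, a)"
  shows "(S a b c d)\<^sup>2 \<le> 1000 * real p"
proof -
  have one: "1 \<le> 1000 * real p" using p_ge by simp
  have perm: "S a b c d = S a b d c" "S a b c d = S b a c d" "S a b c d = S b a d c"
    by (simp_all add: S_def mult_ac)
  show ?thesis
  proof (cases "a = c \<or> a = d \<or> b = c \<or> b = d")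
    case True
    then have "(S a b c d)\<^sup>2 \<le> 1"
      using S_shared[of a b d] S_shared[of a b c] S_shared[of b a d] S_shared[of b a c] in_P1 ne perm
      by auto
    with one show ?thesis by simp
  next
    case False
    obtain g where g: "\<kappa>_moebius g" "g a = None" using move_to_infinity[OF in_P1(1)] by blast
    have "inj_on g P1" using g by (auto simp: \<kappa>_moebius_def bij_betw_def)
    then have "g b \<noteq> None" "g c \<noteq> None" "g d \<noteq> None"
      using False ne(1) in_P1 by (metis g(2) inj_onD)+
    then obtain b' c' d' where bcd: "g b = Some b'" "g c = Some c'" "g d = Some d'" by blast
    have "(S a b c d)\<^sup>2 = (S None (Some b') (Some c') (Some d'))\<^sup>2"
      using S_moebius[OF g(1) in_P1] by (simp add: g(2) bcd)
    \<comment> \<open>The term at e = \<open>None\<close> is zero, and elsewhere the factor of the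
      point at infinity is 1: one root of the quartic has disappeared.\<close>
    also have "S None (Some b') (Some c') (Some d') = (\<Sum>e\<in>F. chi (b' - e) * chi (c' - e) * chi (d' - e))"
      by (simp add: S_def sum_P1)
    finally show ?thesis using cubic_chi_sum by simp
  qed
qed

section \<open>Entries and Frobenius norm of the squared matrix\<close>

lemma B_eq: "B (a, b) (c, d) = (S a b c d)\<^sup>2 - (\<Sum>e\<in>P1. (\<kappa> a e * \<kappa> b e * \<kappa> c e * \<kappa> d e)\<^sup>2)"
proof -
  \<comment> \<open>The summand splits over the two coordinates of R, so the sum over R is a full
    square minus the diagonal that X excludes.\<close>
  have "T (a, b) R * T R (c, d) =
      (\<kappa> a (fst R) * \<kappa> b (fst R) * \<kappa> c (fst R) * \<kappa> d (fst R)) *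
      (\<kappa> a (snd R) * \<kappa> b (snd R) * \<kappa> c (snd R) * \<kappa> d (snd R))" for R
    by (simp add: T_def \<kappa>_commute[of "fst R"] \<kappa>_commute[of "snd R"])
  then show ?thesis
    unfolding B_def S_def
    using sum_offdiag_product[of "\<lambda>e. \<kappa> a e * \<kappa> b e * \<kappa> c e * \<kappa> d e"] by simp
qed

lemma \<kappa>_product_square_le: "(\<kappa> a e * \<kappa> b e * \<kappa> c e * \<kappa> d e)\<^sup>2 \<le> 1"
proof -
  have "(\<kappa> a e)\<^sup>2 * (\<kappa> b e)\<^sup>2 * (\<kappa> c e)\<^sup>2 * (\<kappa> d e)\<^sup>2 \<le> 1 * 1 * 1 * 1"
    by (intro mult_mono \<kappa>_square_le) auto
  then show ?thesis by (simp add: power_mult_distrib)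
qed

text \<open>By \<open>B_eq\<close> an entry lies between -(p + 1) and S^2. If the two unordered
  pairs agree, only |S| \<le> p + 1 \<le> 2 p is used; otherwise \<open>S_bound\<close>
  applies.\<close>

lemma B_square_le:
  assumes P: "P \<in> X" and Q: "Q \<in> X"
  shows "(B P Q)\<^sup>2 \<le> 10^6 * (real p)\<^sup>2 + (if Q \<in> {P, prod.swap P} then 16 * (real p) ^ 4 else 0)"
proof -
  obtain a b c d where eq: "P = (a, b)" "Q = (c, d)" by (metis surj_pair)
  let ?k = "\<lambda>e. \<kappa> a e * \<kappa> b e * \<kappa> c e * \<kappa> d e"
  have k1: "(\<Sum>e\<in>P1. (?k e)\<^sup>2) \<le> real p + 1"
    using sum_bounded_above[of P1 "\<lambda>e. (?k e)\<^sup>2" 1] \<kappa>_product_square_le by (simp add: card_P1 add.commute)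
  have k0: "0 \<le> (\<Sum>e\<in>P1. (?k e)\<^sup>2)" by (intro sum_nonneg) simp
  have p5: "real p \<ge> 5" using p_ge by simp
  show ?thesis
  proof (cases "Q \<in> {P, prod.swap P}")
    case True
    have "\<bar>?k e\<bar> \<le> 1" for e
      using \<kappa>_product_square_le[of a e b c d] by (simp only: abs_square_le_1)
    then have "\<bar>S a b c d\<bar> \<le> real p + 1"
      unfolding S_def
      using sum_bounded_above[of P1 "\<lambda>e. \<bar>?k e\<bar>" 1]
      by (intro order_trans[OF sum_abs]) (simp add: card_P1)
    then have "(S a b c d)\<^sup>2 \<le> (real p + 1)\<^sup>2" by (metis abs_le_square_iff abs_of_nonneg add_nonneg_nonneg of_nat_0_le_iff zero_le_one)
    also have "\<dots> \<le> (2 * real p)\<^sup>2" using p5 by (intro power_mono) auto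
    finally have S: "(S a b c d)\<^sup>2 \<le> 4 * (real p)\<^sup>2" by (simp add: power_mult_distrib)
    have "real p + 1 \<le> 4 * (real p)\<^sup>2"
    proof -
      have "real p * 1 \<le> real p * real p" using p5 by (intro mult_left_mono) auto
      then show ?thesis unfolding power2_eq_square using p5 by linarith
    qed
    then have "\<bar>B P Q\<bar> \<le> 4 * (real p)\<^sup>2"
      unfolding eq B_eq using S k0 k1 zero_le_power2[of "S a b c d"] by linarith
    then have "(B P Q)\<^sup>2 \<le> (4 * (real p)\<^sup>2)\<^sup>2" by (metis abs_le_square_iff abs_of_nonneg mult_nonneg_nonneg zero_le_numeral zero_le_power2)
    also have "\<dots> = 16 * real p ^ 4" by (simp add: power_mult_distrib flip: power_mult)
    finally show ?thesis using True by (simp add: add_increasing)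
  next
    case False
    then have "(S a b c d)\<^sup>2 \<le> 1000 * real p"
      using P Q by (intro S_bound) (auto simp: X_def eq)
    then have "\<bar>B P Q\<bar> \<le> 1000 * real p"
      unfolding eq B_eq using k0 k1 zero_le_power2[of "S a b c d"] p5 by linarith
    then have "(B P Q)\<^sup>2 \<le> (1000 * real p)\<^sup>2" by (metis abs_le_square_iff abs_of_nonneg mult_nonneg_nonneg zero_le_numeral of_nat_0_le_iff)
    then show ?thesis using False by (simp add: power_mult_distrib)
  qed
qed

text \<open>The constant is 4 (4 * 10^6 + 32) rounded up: 4 p^2 bounds the number of pairs, and 32
  comes from the at most two entries of a row without cancellation.\<close>

lemma B_frobenius_le: "(\<Sum>P\<in>X. \<Sum>Q\<in>X. (B P Q)\<^sup>2) \<le> 2 * 10^7 * real p ^ 6"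
proof -
  have p5: "real p \<ge> 5" using p_ge by simp
  have "real (card X) \<le> real ((p + 1)\<^sup>2)" using card_X_le by (simp only: of_nat_le_iff)
  also have "\<dots> \<le> (2 * real p)\<^sup>2" unfolding of_nat_power using p5 by (intro power_mono) auto
  finally have card: "real (card X) \<le> 4 * (real p)\<^sup>2" by (simp add: power_mult_distrib)
  have row: "(\<Sum>Q\<in>X. (B P Q)\<^sup>2) \<le> 10^7 / 2 * real p ^ 4" if P: "P \<in> X" for P
  proof -
    have "(\<Sum>Q\<in>X. (B P Q)\<^sup>2) \<le>
        (\<Sum>Q\<in>X. 10^6 * (real p)\<^sup>2 + (if Q \<in> {P, prod.swap P} then 16 * (real p) ^ 4 else 0))"
      using P by (intro sum_mono B_square_le)
    also have "\<dots> = real (card X) * (10^6 * (real p)\<^sup>2) + real (card (X \<inter> {P, prod.swap P})) * (16 * real p ^ 4)"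
      by (simp only: sum.distrib sum.inter_restrict[OF finite_X, symmetric] sum_constant)
    also have "\<dots> \<le> (4 * (real p)\<^sup>2) * (10^6 * (real p)\<^sup>2) + 2 * (16 * real p ^ 4)"
    proof (intro add_mono mult_right_mono card)
      have "card (X \<inter> {P, prod.swap P}) \<le> card {P, prod.swap P}" by (intro card_mono) auto
      also have "\<dots> \<le> 2" by (simp add: card_insert_if)
      finally show "real (card (X \<inter> {P, prod.swap P})) \<le> 2" by simp
    qed auto
    also have "\<dots> = (4 * 10^6 + 32) * real p ^ 4"
      by (simp add: distrib_right flip: power_add)
    also have "\<dots> \<le> 10^7 / 2 * real p ^ 4" by (intro mult_right_mono) auto
    finally show ?thesis .
  qed
  have "(\<Sum>P\<in>X. \<Sum>Q\<in>X. (B P Q)\<^sup>2) \<le> real (card X) * (10^7 / 2 * real p ^ 4)"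
    using row by (intro sum_bounded_above)
  also have "\<dots> \<le> (4 * (real p)\<^sup>2) * (10^7 / 2 * real p ^ 4)"
    by (intro mult_right_mono card) simp
  also have "\<dots> = 2 * 10^7 * real p ^ 6" by (simp flip: power_add)
  finally show ?thesis .
qed

sublocale aff: affine_action p X "\<lambda>t. map_prod (shift t) (shift t)"
  "\<lambda>\<alpha>. map_prod (dilate \<alpha>) (dilate \<alpha>)" B
proof
  show "prime p" "finite X" by (fact p finite_X)+
next
  fix \<alpha> assume "\<alpha> \<in> {1..<int p}"
  then have "\<not> int p dvd \<alpha>" using not_dvd_F by simp
  then have d: "\<kappa>_moebius (dilate \<alpha>)" by (rule \<kappa>_moebius_dilate)
  show "bij_betw (map_prod (dilate \<alpha>) (dilate \<alpha>)) X X"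
    by (rule bij_betw_X_moebius[OF d])
  show "B (map_prod (dilate \<alpha>) (dilate \<alpha>) x) (map_prod (dilate \<alpha>) (dilate \<alpha>) y) = B x y"
    if "x \<in> X" "y \<in> X" for x y using d that by (rule B_moebius)
  show "map_prod (dilate \<alpha>) (dilate \<alpha>) (map_prod (shift t) (shift t) x) =
      map_prod (shift (\<alpha> * t)) (shift (\<alpha> * t)) (map_prod (dilate \<alpha>) (dilate \<alpha>) x)" for t x
    by (cases x) (simp add: dilate_shift)
qed (auto simp: shift_shift shift_mod bij_betw_X_moebius B_moebius \<kappa>_moebius_shift)


section \<open>Translation invariant functions under the inversion\<close>

lemma sum_X_moebius:
  assumes "\<kappa>_moebius g"
  shows "(\<Sum>P\<in>X. f (map_prod g g P)) = (\<Sum>P\<in>X. f P)"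
  using bij_betw_X_moebius[OF assms] by (rule sum.reindex_bij_betw)

definition swap_symmetric :: "(int option \<times> int option \<Rightarrow> real) \<Rightarrow> bool" where
  "swap_symmetric v \<longleftrightarrow> (\<forall>P\<in>X. v (prod.swap P) = v P)"

lemma swap_symmetric_avg:
  assumes "swap_symmetric v"
  shows "swap_symmetric (aff.avg v)"
  unfolding swap_symmetric_def
proof
  fix P assume P: "P \<in> X"
  have "v (map_prod (shift t) (shift t) (prod.swap P)) = v (map_prod (shift t) (shift t) P)" for t
  proof -
    have "map_prod (shift t) (shift t) (prod.swap P) = prod.swap (map_prod (shift t) (shift t) P)"
      by (cases P) simp
    then show ?thesis using assms aff.\<sigma>_in[OF P] by (simp add: swap_symmetric_def)
  qed
  then show "aff.avg v (prod.swap P) = aff.avg v P" by (simp add: aff.avg_def)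
qed

text \<open>The inversion maps \<open>{(None, Some b)}\<close> to a set meeting every other translation orbit once;
  symmetry under swapping makes up for the missing one.\<close>

definition core :: "(int option \<times> int option \<Rightarrow> real) \<Rightarrow> bool" where
  "core v \<longleftrightarrow> swap_symmetric v \<and> (\<Sum>P\<in>X. v P) = 0 \<and>
    (\<forall>P\<in>X. \<forall>t. v (map_prod (shift t) (shift t) P) = v P)"

lemma core_avg:
  assumes "swap_symmetric v" "(\<Sum>P\<in>X. v P) = 0"
  shows "core (aff.avg v)"
  using assms by (simp add: core_def swap_symmetric_avg aff.sum_avg aff.avg_\<sigma>)

lemma core_invert:
  assumes "core v"
  shows "core (aff.avg (\<lambda>P. v (map_prod invert invert P)))"
proof (rule core_avg)
  have in_X: "map_prod invert invert P \<in> X" if "P \<in> X" for P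
    using bij_betw_X_moebius[OF \<kappa>_moebius_invert] that by (rule bij_betw_apply)
  show "swap_symmetric (\<lambda>P. v (map_prod invert invert P))"
    unfolding swap_symmetric_def
  proof
    fix P assume "P \<in> X"
    moreover have "map_prod invert invert (prod.swap P) = prod.swap (map_prod invert invert P)"
      by (cases P) simp
    ultimately show "v (map_prod invert invert (prod.swap P)) = v (map_prod invert invert P)"
      using assms in_X by (simp add: core_def swap_symmetric_def)
  qed
  show "(\<Sum>P\<in>X. v (map_prod invert invert P)) = 0"
    using assms by (simp add: sum_X_moebius[OF \<kappa>_moebius_invert] core_def)
qed

text \<open>Invariance makes the p rows with finite first point equal, which gives p Z. The row of
  \<open>None\<close> is a single orbit, and swapping identifies its value with that at (Some 0,
  None), one term of Z; so it adds at most p Z.\<close>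

lemma sum_X_le_orbit:
  fixes f :: "int option \<times> int option \<Rightarrow> real"
  assumes nonneg: "\<And>P. f P \<ge> 0" and sym: "\<And>P. P \<in> X \<Longrightarrow> f (prod.swap P) = f P"
    and inv: "\<And>P t. P \<in> X \<Longrightarrow> f (map_prod (shift t) (shift t) P) = f P"
  shows "(\<Sum>P\<in>X. f P) \<le> 2 * real p * (\<Sum>y\<in>P1 - {Some 0}. f (Some 0, y))"
proof -
  define Z where "Z = (\<Sum>y\<in>P1 - {Some 0}. f (Some 0, y))"
  have None_in: "None \<in> P1" and Some_in: "a \<in> F \<Longrightarrow> Some a \<in> P1" for a by (auto simp: P1_def)
  have zero: "0 \<in> F" using p_ge by simp
  have fin: "(\<Sum>b\<in>P1 - {Some a}. f (Some a, b)) = Z" if a: "a \<in> F" for a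
  proof -
    have "Z = (\<Sum>y\<in>P1 - {Some 0}. f (Some a, shift a y))"
      unfolding Z_def
    proof (intro sum.cong refl)
      fix y assume "y \<in> P1 - {Some 0}"
      then have "(Some 0, y) \<in> X" using Some_in zero by (auto simp: X_def)
      from inv[OF this, of a] show "f (Some 0, y) = f (Some a, shift a y)"
        using a by (simp add: shift_def)
    qed
    also have "\<dots> = (\<Sum>b\<in>P1 - {Some a}. f (Some a, b))"
    proof (rule sum.reindex_bij_witness[of _ "shift (- a)" "shift a"])
      fix b assume b: "b \<in> P1 - {Some a}"
      show "shift a (shift (- a) b) = b" using b by (simp add: shift_shift shift_0)
      have "shift (- a) b \<noteq> Some 0"
      proof
        assume "shift (- a) b = Some 0"
        then have "shift a (shift (- a) b) = shift a (Some 0)" by simp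
        also have "\<dots> = Some a" using a by (simp add: shift_def)
        finally have "shift a (shift (- a) b) = Some a" .
        then show False using b by (simp add: shift_shift shift_0)
      qed
      then show "shift (- a) b \<in> P1 - {Some 0}" using b by (simp add: shift_P1)
    next
      fix y assume y: "y \<in> P1 - {Some 0}"
      show "shift (- a) (shift a y) = y" using y by (simp add: shift_shift shift_0)
      have "shift a y \<noteq> Some a"
      proof
        assume "shift a y = Some a"
        then have "shift (- a) (shift a y) = shift (- a) (Some a)" by simp
        also have "\<dots> = Some 0" by (simp add: shift_def)
        finally have "shift (- a) (shift a y) = Some 0" .
        then show False using y by (simp add: shift_shift shift_0)
      qed
      then show "shift a y \<in> P1 - {Some a}" using y by (simp add: shift_P1)
    qed simp
    finally show ?thesis ..
  qed
  have inf: "f (None, Some b) \<le> Z" if b: "b \<in> F" for b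
  proof -
    have "(Some 0, None) \<in> X" "(Some b, None) \<in> X"
      using Some_in[OF zero] Some_in[OF b] None_in by (auto simp: X_def)
    then have "f (None, Some b) = f (Some 0, None)"
      using inv[of "(Some 0, None)" b] sym[of "(Some b, None)"] b by (simp add: shift_def)
    also have "\<dots> \<le> Z"
      unfolding Z_def using finite_P1 None_in nonneg by (intro member_le_sum) auto
    finally show ?thesis .
  qed
  have "P1 - {None} = Some ` F" by (auto simp: P1_def)
  then have "(\<Sum>b\<in>P1 - {None}. f (None, b)) = (\<Sum>b\<in>F. f (None, Some b))"
    by (simp add: sum.reindex)
  also have "\<dots> \<le> real (card F) * Z" by (intro sum_bounded_above inf)
  finally have "(\<Sum>b\<in>P1 - {None}. f (None, b)) \<le> real p * Z" by simp
  moreover have "(\<Sum>P\<in>X. f P) = (\<Sum>b\<in>P1 - {None}. f (None, b)) + real p * Z"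
    unfolding sum_X sum_P1 by (simp add: fin)
  ultimately show ?thesis by (simp add: Z_def)
qed

text \<open>Composition with the inversion lines up the values v (Some 0, y) on the single orbit of
  (None, Some 0). Averaging makes them equal to c there, so the loss of squared norm is at least Z,
  their quadratic deviation from c. In turn Z is at least \<open>aff.sqn v\<close> / (2 p), by
  \<open>sum_X_le_orbit\<close> applied to (v - c)^2.\<close>

lemma core_contraction:
  assumes "core v"
  shows "aff.sqn (aff.avg (\<lambda>P. v (map_prod invert invert P))) \<le> (1 - 1 / (2 * real p)) * aff.sqn v"
proof -
  define u where "u = (\<lambda>P. v (map_prod invert invert P))"
  define a where "a = aff.avg u"
  define c where "c = a (None, Some 0)"
  define Z where "Z = (\<Sum>y\<in>P1 - {Some 0}. (v (Some 0, y) - c)\<^sup>2)"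
  have v: "\<And>P. P \<in> X \<Longrightarrow> v (prod.swap P) = v P" "(\<Sum>P\<in>X. v P) = 0"
      "\<And>P t. P \<in> X \<Longrightarrow> v (map_prod (shift t) (shift t) P) = v P"
    using assms by (auto simp: core_def swap_symmetric_def)
  have zero: "0 \<in> F" using p_ge by simp
  \<comment> \<open>As v sums to 0, subtracting a constant cannot decrease the norm.\<close>
  have "aff.sqn v \<le> (\<Sum>P\<in>X. (v P - c)\<^sup>2)"
  proof -
    have "(\<Sum>P\<in>X. (v P - c)\<^sup>2) = (\<Sum>P\<in>X. (v P)\<^sup>2 - 2 * c * v P + c\<^sup>2)"
      by (intro sum.cong refl) (simp add: power2_eq_square algebra_simps)
    also have "\<dots> = aff.sqn v - 2 * c * (\<Sum>P\<in>X. v P) + real (card X) * c\<^sup>2"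
      by (simp add: sum.distrib sum_subtractf sum_distrib_left aff.sqn_def)
    finally show ?thesis using v(2) by simp
  qed
  also have "\<dots> \<le> 2 * real p * Z"
    unfolding Z_def by (intro sum_X_le_orbit) (simp_all add: v)
  finally have vZ: "aff.sqn v \<le> 2 * real p * Z" .
  have "Z = (\<Sum>x\<in>F. (u (None, Some x) - c)\<^sup>2)"
    unfolding Z_def
  proof (rule sum.reindex_bij_witness[of _ "\<lambda>x. invert (Some x)" "\<lambda>y. the (invert y)"])
    fix y assume y: "y \<in> P1 - {Some 0}"
    have inv: "invert y \<in> P1" "invert (invert y) = y" using y by (simp_all add: invert_P1 invert_invert)
    have "invert None = Some 0" by (simp add: invert_def)
    then have "invert y \<noteq> None" using y inv(2) by force
    then obtain x where x: "invert y = Some x" by blast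
    show "invert (Some (the (invert y))) = y" "the (invert y) \<in> F"
      using inv x by (auto simp: P1_def)
    show "(u (None, Some (the (invert y))) - c)\<^sup>2 = (v (Some 0, y) - c)\<^sup>2"
      using inv x by (simp add: u_def) (simp add: invert_def)
  next
    fix x assume "x \<in> F"
    then have x: "Some x \<in> P1" by (simp add: P1_def)
    show "the (invert (invert (Some x))) = x" using x by (simp add: invert_invert)
    have "invert (Some x) \<noteq> Some 0"
    proof
      assume "invert (Some x) = Some 0"
      then have "invert (invert (Some x)) = None" by (simp add: invert_def)
      then show False using x by (simp add: invert_invert)
    qed
    then show "invert (Some x) \<in> P1 - {Some 0}" using x by (simp add: invert_P1)
  qed
  also have "\<dots> = (\<Sum>x\<in>F. (u (None, Some x) - a (None, Some x))\<^sup>2)"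
  proof (intro sum.cong refl)
    fix x assume x: "x \<in> F"
    have "(None, Some 0) \<in> X" using zero by (auto simp: X_def P1_def)
    from aff.avg_\<sigma>[OF this, of u x] have "a (None, Some x) = c"
      using x by (simp add: a_def c_def shift_def)
    then show "(u (None, Some x) - c)\<^sup>2 = (u (None, Some x) - a (None, Some x))\<^sup>2" by simp
  qed
  also have "\<dots> = (\<Sum>P\<in>(\<lambda>x. (None, Some x)) ` F. (u P - a P)\<^sup>2)"
    by (simp add: sum.reindex inj_on_def)
  also have "\<dots> \<le> aff.sqn (\<lambda>P. u P - a P)"
    unfolding aff.sqn_def by (intro sum_mono2 finite_X) (auto simp: X_def P1_def)
  also have "\<dots> = aff.sqn u - aff.sqn a" using aff.sqn_avg[of u] by (simp add: a_def)
  also have "aff.sqn u = aff.sqn v"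
    using sum_X_moebius[OF \<kappa>_moebius_invert, of "\<lambda>P. (v P)\<^sup>2"] by (simp add: aff.sqn_def u_def)
  finally have Za: "Z \<le> aff.sqn v - aff.sqn a" .
  have "aff.sqn v / (2 * real p) \<le> Z" using vZ p_ge by (simp add: field_simps)
  with Za have "aff.sqn a \<le> aff.sqn v - aff.sqn v / (2 * real p)" by simp
  then show ?thesis by (simp add: a_def u_def left_diff_distrib)
qed

text \<open>The inversion is used for the average of v alone; \<open>sqn_mulB_le_avg\<close> covers
  the rest, and the squared norms of the two parts add up.\<close>

lemma B_bound_sum_zero:
  assumes "swap_symmetric v" "(\<Sum>P\<in>X. v P) = 0"
  shows "real (p - 1) * aff.sqn (aff.mulB v) \<le> aff.frob * aff.sqn v"
proof -
  have "real (p - 1) * aff.sqn (aff.mulB (aff.avg v)) \<le> aff.frob * aff.sqn (aff.avg v)"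
  proof (rule aff.contraction_bound[where Q = core])
    show "bij_betw (map_prod invert invert) X X"
      by (rule bij_betw_X_moebius[OF \<kappa>_moebius_invert])
    show "core (aff.avg v)" using assms by (rule core_avg)
    show "0 \<le> 1 - 1 / (2 * real p)" "1 - 1 / (2 * real p) < 1" using p_ge by (simp_all add: field_simps)
  qed (simp_all add: B_moebius[OF \<kappa>_moebius_invert] core_invert core_contraction)
  with aff.sqn_mulB_le_avg[of v] show ?thesis by (simp add: right_diff_distrib)
qed

section \<open>Constant functions and the bound for the extended matrix\<close>

lemma T_row_sum:
  assumes "P \<in> X"
  shows "(\<Sum>Q\<in>X. T P Q) = - real (p - 1)"
proof -
  obtain a b where P: "P = (a, b)" by (metis surj_pair)
  then have ab: "a \<in> P1" "b \<in> P1" "a \<noteq> b" using assms by (auto simp: X_def)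
  let ?k = "\<lambda>e. \<kappa> a e * \<kappa> b e"
  have "(\<Sum>Q\<in>X. T P Q) = (\<Sum>Q\<in>X. ?k (fst Q) * ?k (snd Q))"
    by (intro sum.cong refl) (simp add: T_def P)
  \<comment> \<open>The full square is zero by \<open>quadratic_\<kappa>_sum\<close>; what remains
    counts the p - 1 points other than a and b.\<close>
  also have "\<dots> = - (\<Sum>e\<in>P1. (?k e)\<^sup>2)"
    using sum_offdiag_product[of ?k] quadratic_\<kappa>_sum[OF ab] by simp
  also have "(\<Sum>e\<in>P1. (?k e)\<^sup>2) = (\<Sum>e\<in>P1 - {a, b}. (?k e)\<^sup>2)"
    using finite_P1 by (intro sum.mono_neutral_right) auto
  also have "\<dots> = (\<Sum>e\<in>P1 - {a, b}. 1)"
    using ab by (intro sum.cong refl) (subst power_mult_distrib, subst \<kappa>_square, auto simp: \<kappa>_square)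
  also have "\<dots> = real (card (P1 - {a, b}))" by simp
  also have "card (P1 - {a, b}) = p - 1" using ab finite_P1 by (simp add: card_Diff_subset card_P1)
  finally show ?thesis .
qed

lemma B_row_sum:
  assumes "P \<in> X"
  shows "(\<Sum>Q\<in>X. B P Q) = (real (p - 1))\<^sup>2"
proof -
  have "(\<Sum>Q\<in>X. B P Q) = (\<Sum>R\<in>X. T P R * (\<Sum>Q\<in>X. T R Q))"
    unfolding B_def sum_distrib_left by (rule sum.swap)
  also have "\<dots> = (\<Sum>R\<in>X. T P R * - real (p - 1))"
    by (intro sum.cong refl) (simp only: T_row_sum)
  also have "\<dots> = (\<Sum>R\<in>X. T P R) * - real (p - 1)" by (rule sum_distrib_right[symmetric])
  also have "\<dots> = (real (p - 1))\<^sup>2"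
    using T_row_sum[OF assms] by (simp add: power2_eq_square)
  finally show ?thesis .
qed

lemma B_commute: "B P Q = B Q P"
  unfolding B_def by (simp add: T_commute[of P] T_commute[of _ Q] mult.commute)

text \<open>On constants B is the scalar (p - 1)^2, whose square is below p^5. B keeps the sum of w
  at 0, so the images of the constant part and of w stay orthogonal.\<close>

lemma B_bound:
  assumes sym: "swap_symmetric v"
  shows "aff.sqn (aff.mulB v) \<le> 4 * 10^7 * real p ^ 5 * aff.sqn v"
proof -
  define m where "m = (\<Sum>P\<in>X. v P) / real (card X)"
  define w where "w = (\<lambda>P. v P - m)"
  define K where "K = 4 * 10^7 * real p ^ 5"
  have p1: "real (p - 1) = real p - 1" "real p \<ge> 5" using p_ge by (simp_all add: of_nat_diff)
  have "(None, Some 0) \<in> X" using p_ge by (auto simp: X_def P1_def)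
  then have "card X > 0" using finite_X by (auto simp: card_gt_0_iff)
  then have w0: "(\<Sum>P\<in>X. w P) = 0" by (simp add: w_def m_def sum_subtractf)
  have "swap_symmetric w" using sym by (simp add: swap_symmetric_def w_def)
  from B_bound_sum_zero[OF this w0]
  have "real (p - 1) * aff.sqn (aff.mulB w) \<le> aff.frob * aff.sqn w" .
  also have "\<dots> \<le> (2 * 10^7 * real p ^ 6) * aff.sqn w"
    unfolding aff.frob_def by (intro mult_right_mono B_frobenius_le aff.sqn_nonneg)
  \<comment> \<open>Splitting off p / 2 \<le> p - 1 turns the Frobenius constant 2 * 10^7 into 4 *
    10^7.\<close>
  also have "\<dots> = (real p / 2) * (K * aff.sqn w)"
  proof -
    have "real p ^ 6 = real p * real p ^ 5" by (simp flip: power_Suc)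
    then show ?thesis by (simp add: K_def)
  qed
  also have "\<dots> \<le> real (p - 1) * (K * aff.sqn w)"
    using p1 by (intro mult_right_mono) (auto simp: K_def aff.sqn_nonneg)
  finally have Bw: "aff.sqn (aff.mulB w) \<le> K * aff.sqn w"
    using p1 by (simp add: mult_le_cancel_left_pos)
  have split: "aff.sqn (\<lambda>P. m' + w' P) = real (card X) * m'\<^sup>2 + aff.sqn w'"
    if "(\<Sum>P\<in>X. w' P) = 0" for m' w'
  proof -
    have "aff.sqn (\<lambda>P. m' + w' P) = (\<Sum>P\<in>X. m'\<^sup>2 + 2 * m' * w' P + (w' P)\<^sup>2)"
      unfolding aff.sqn_def by (intro sum.cong refl) (simp add: power2_eq_square algebra_simps)
    also have "\<dots> = real (card X) * m'\<^sup>2 + 2 * m' * (\<Sum>P\<in>X. w' P) + aff.sqn w'"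
      by (simp add: sum.distrib sum_distrib_left aff.sqn_def)
    finally show ?thesis using that by simp
  qed
  have "(\<Sum>P\<in>X. aff.mulB w P) = (\<Sum>Q\<in>X. (\<Sum>P\<in>X. B Q P) * w Q)"
    unfolding aff.mulB_def by (subst sum.swap) (simp add: sum_distrib_right B_commute)
  also have "\<dots> = 0" by (simp add: B_row_sum w0 flip: sum_distrib_left)
  finally have Bw0: "(\<Sum>P\<in>X. aff.mulB w P) = 0" .
  have Bv: "aff.mulB v P = (real (p - 1))\<^sup>2 * m + aff.mulB w P" if "P \<in> X" for P
  proof -
    have "aff.mulB v P = (\<Sum>Q\<in>X. B P Q * m + B P Q * w Q)"
      unfolding aff.mulB_def by (intro sum.cong refl) (simp add: w_def algebra_simps)
    then show ?thesis
      using B_row_sum[OF that] by (simp add: sum.distrib aff.mulB_def flip: sum_distrib_right)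
  qed
  have "aff.sqn (aff.mulB v) = real (card X) * ((real (p - 1))\<^sup>2 * m)\<^sup>2 + aff.sqn (aff.mulB w)"
    using split[OF Bw0] aff.sqn_cong[OF Bv] by simp
  also have "\<dots> \<le> K * (real (card X) * m\<^sup>2) + K * aff.sqn w"
  proof (intro add_mono Bw)
    have "real (p - 1) ^ 4 \<le> real p ^ 4" by (intro power_mono) auto
    also have "\<dots> \<le> real p ^ 5" using p1(2) by (intro power_increasing) auto
    also have "\<dots> \<le> K" unfolding K_def by simp
    finally have "real (p - 1) ^ 4 * (real (card X) * m\<^sup>2) \<le> K * (real (card X) * m\<^sup>2)"
      by (intro mult_right_mono) auto
    then show "real (card X) * ((real (p - 1))\<^sup>2 * m)\<^sup>2 \<le> K * (real (card X) * m\<^sup>2)"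
      by (simp add: power_mult_distrib mult_ac flip: power_mult)
  qed
  also have "\<dots> = K * aff.sqn v"
    using split[OF w0, of m] by (simp add: w_def distrib_left)
  finally show ?thesis by (simp add: K_def)
qed

text \<open>As T is symmetric, |T v|^2 is the inner product of v with T^2 v; Cauchy-Schwarz bounds
  it by |v| |B v|, and squaring avoids roots.\<close>

lemma T_bound:
  assumes sym: "swap_symmetric v"
  shows "(\<Sum>P\<in>X. (\<Sum>Q\<in>X. T P Q * v Q)\<^sup>2)\<^sup>2 \<le> 4 * 10^7 * real p ^ 5 * (\<Sum>P\<in>X. (v P)\<^sup>2)\<^sup>2"
proof -
  define u where "u = (\<lambda>P. \<Sum>Q\<in>X. T P Q * v Q)"
  have "aff.mulB v P = (\<Sum>R\<in>X. T P R * u R)" for P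
  proof -
    have "aff.mulB v P = (\<Sum>Q\<in>X. \<Sum>R\<in>X. T P R * (T R Q * v Q))"
      by (simp add: aff.mulB_def B_def sum_distrib_right mult.assoc)
    also have "\<dots> = (\<Sum>R\<in>X. \<Sum>Q\<in>X. T P R * (T R Q * v Q))" by (rule sum.swap)
    finally show ?thesis by (simp add: u_def sum_distrib_left)
  qed
  then have "(\<Sum>P\<in>X. v P * aff.mulB v P) = (\<Sum>P\<in>X. \<Sum>R\<in>X. v P * (T P R * u R))"
    by (simp add: sum_distrib_left)
  also have "\<dots> = (\<Sum>R\<in>X. \<Sum>P\<in>X. v P * (T P R * u R))" by (rule sum.swap)
  also have "\<dots> = (\<Sum>R\<in>X. u R * u R)"
  proof (intro sum.cong refl)
    fix R
    have "(\<Sum>P\<in>X. v P * (T P R * u R)) = (\<Sum>P\<in>X. T R P * v P) * u R"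
      unfolding sum_distrib_right by (intro sum.cong refl) (subst T_commute, simp)
    then show "(\<Sum>P\<in>X. v P * (T P R * u R)) = u R * u R" by (simp add: u_def)
  qed
  finally have "(\<Sum>P\<in>X. (u P)\<^sup>2)\<^sup>2 = (\<Sum>P\<in>X. v P * aff.mulB v P)\<^sup>2" by (simp add: power2_eq_square)
  also have "\<dots> \<le> (\<Sum>P\<in>X. (v P)\<^sup>2) * (\<Sum>P\<in>X. (aff.mulB v P)\<^sup>2)" by (rule Cauchy_Schwarz_ineq_sum)
  also have "\<dots> \<le> (\<Sum>P\<in>X. (v P)\<^sup>2) * (4 * 10^7 * real p ^ 5 * (\<Sum>P\<in>X. (v P)\<^sup>2))"
    using B_bound[OF sym] by (intro mult_left_mono sum_nonneg) (simp_all add: aff.sqn_def)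
  finally show ?thesis by (simp add: u_def power2_eq_square mult_ac)
qed

end

section \<open>Return to unordered pairs of residues\<close>

lemma sum_ordered_pairs:
  fixes f :: "'a set \<Rightarrow> real"
  assumes A: "finite A"
  shows "(\<Sum>P | fst P \<in> A \<and> snd P \<in> A \<and> fst P \<noteq> snd P. f {fst P, snd P})
    = 2 * (\<Sum>S | S \<subseteq> A \<and> card S = 2. f S)"
proof -
  let ?Y = "{P. fst P \<in> A \<and> snd P \<in> A \<and> fst P \<noteq> snd P}" and ?Z = "{S. S \<subseteq> A \<and> card S = 2}"
  have "?Y \<subseteq> A \<times> A" by auto
  then have finY: "finite ?Y" using A by (meson finite_SigmaI finite_subset)
  have finZ: "finite ?Z" using A by simp
  have "(\<Sum>P\<in>?Y. f {fst P, snd P}) =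
      (\<Sum>S\<in>?Z. \<Sum>P | P \<in> ?Y \<and> {fst P, snd P} = S. f {fst P, snd P})"
    by (rule sum.group[symmetric, OF finY finZ]) auto
  also have "\<dots> = (\<Sum>S\<in>?Z. 2 * f S)"
  proof (intro sum.cong refl)
    fix S assume "S \<in> ?Z"
    then obtain a b where S: "S = {a, b}" "a \<noteq> b" "a \<in> A" "b \<in> A"
      by (auto simp: card_2_iff)
    then have "{P. P \<in> ?Y \<and> {fst P, snd P} = S} = {(a, b), (b, a)}"
      by (auto simp: doubleton_eq_iff)
    then show "(\<Sum>P | P \<in> ?Y \<and> {fst P, snd P} = S. f {fst P, snd P}) = 2 * f S"
      using S by (simp add: insert_commute)
  qed
  finally show ?thesis by (simp add: sum_distrib_left)
qed

context paley_prime
begin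

lemma T_Some:
  assumes "a \<noteq> b" "c \<noteq> d"
  shows "T (Some a, Some b) (Some c, Some d) = T441 p {a, b} {c, d}"
proof (cases "{a, b} \<inter> {c, d} = {}")
  case True
  then show ?thesis using T441_doubleton[OF assms] by (simp add: T_def chi_def)
next
  case False
  then show ?thesis by (auto simp: T_def T441_def chi_0)
qed

lemma T441_bound:
  fixes x :: "int set \<Rightarrow> real"
  defines "y \<equiv> \<lambda>S. \<Sum>U\<in>pairs_mod p. T441 p S U * x U"
  shows "L2_set y (pairs_mod p) \<le> 40 * real p powr (5 / 4) * L2_set x (pairs_mod p)"
proof -
  define Y where "Y = {P. fst P \<in> F \<and> snd P \<in> F \<and> fst P \<noteq> snd P}"
  define \<phi> :: "int \<times> int \<Rightarrow> int option \<times> int option" where "\<phi> = map_prod Some Some"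
  \<comment> \<open>x is read on ordered pairs and extended by 0 to pairs that contain the point at
    infinity.\<close>
  define v where "v = (\<lambda>Q. case Q of (Some a, Some b) \<Rightarrow> x {a, b} | _ \<Rightarrow> 0)"
  have inj: "inj_on \<phi> Y" by (auto simp: \<phi>_def inj_on_def)
  have \<phi>_X: "\<phi> ` Y \<subseteq> X" by (auto simp: \<phi>_def Y_def X_def P1_def)
  have v_\<phi>: "v (\<phi> P) = x {fst P, snd P}" for P by (cases P) (simp add: v_def \<phi>_def)
  have v_0: "v Q = 0" if "Q \<in> X - \<phi> ` Y" for Q
  proof (rule ccontr)
    assume "v Q \<noteq> 0"
    then obtain a b where Q: "Q = (Some a, Some b)"
      by (cases Q) (auto simp: v_def split: option.splits)
    then have "(a, b) \<in> Y" "Q = \<phi> (a, b)" using that by (auto simp: X_def P1_def Y_def \<phi>_def)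
    then show False using that by blast
  qed
  have restrict: "(\<Sum>Q\<in>X. g Q) = (\<Sum>P\<in>Y. g (\<phi> P))"
    if "\<And>Q. Q \<in> X - \<phi> ` Y \<Longrightarrow> g Q = 0" for g :: "int option \<times> int option \<Rightarrow> real"
  proof -
    have "(\<Sum>Q\<in>X. g Q) = (\<Sum>Q\<in>\<phi> ` Y. g Q)"
      using that \<phi>_X finite_X by (intro sum.mono_neutral_right) auto
    then show ?thesis using inj by (simp add: sum.reindex)
  qed
  have pairs: "(\<Sum>P\<in>Y. f {fst P, snd P}) = 2 * (\<Sum>S\<in>pairs_mod p. f S)" for f :: "int set \<Rightarrow> real"
    using sum_ordered_pairs[of F f] by (simp add: Y_def pairs_mod_def)
  have Tv: "(\<Sum>Q\<in>X. T (\<phi> P) Q * v Q) = 2 * y {fst P, snd P}" if P: "P \<in> Y" for P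
  proof -
    have T_\<phi>: "T (\<phi> P) (\<phi> Q) = T441 p {fst P, snd P} {fst Q, snd Q}" if "Q \<in> Y" for Q
      using P that by (cases P; cases Q) (auto simp: Y_def \<phi>_def T_Some)
    have "(\<Sum>Q\<in>X. T (\<phi> P) Q * v Q) = (\<Sum>Q\<in>Y. T (\<phi> P) (\<phi> Q) * v (\<phi> Q))"
      by (rule restrict) (simp add: v_0)
    also have "\<dots> = (\<Sum>Q\<in>Y. T441 p {fst P, snd P} {fst Q, snd Q} * x {fst Q, snd Q})"
      by (intro sum.cong refl) (simp add: v_\<phi> T_\<phi>)
    also have "\<dots> = 2 * y {fst P, snd P}"
      unfolding y_def by (rule pairs)
    finally show ?thesis .
  qed
  have sym: "swap_symmetric v"
    by (auto simp: swap_symmetric_def v_def insert_commute split: option.splits)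
  \<comment> \<open>Each unordered pair counts twice outside the square and twice inside it: 8 = 2 *
    2^2. The rows that involve infinity are then added, which only increases the sum.\<close>
  have "8 * (\<Sum>S\<in>pairs_mod p. (y S)\<^sup>2) = (\<Sum>P\<in>Y. (2 * y {fst P, snd P})\<^sup>2)"
    using pairs[of "\<lambda>S. (2 * y S)\<^sup>2"] by (simp add: power_mult_distrib sum_distrib_left)
  also have "\<dots> = (\<Sum>P\<in>\<phi> ` Y. (\<Sum>Q\<in>X. T P Q * v Q)\<^sup>2)"
    using inj by (simp add: sum.reindex Tv)
  also have "\<dots> \<le> (\<Sum>P\<in>X. (\<Sum>Q\<in>X. T P Q * v Q)\<^sup>2)"
    using finite_X \<phi>_X by (intro sum_mono2) auto
  finally have lower: "8 * (\<Sum>S\<in>pairs_mod p. (y S)\<^sup>2) \<le> (\<Sum>P\<in>X. (\<Sum>Q\<in>X. T P Q * v Q)\<^sup>2)" .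
  have upper: "(\<Sum>P\<in>X. (v P)\<^sup>2) = 2 * (\<Sum>S\<in>pairs_mod p. (x S)\<^sup>2)"
    using restrict[of "\<lambda>P. (v P)\<^sup>2"] pairs[of "\<lambda>S. (x S)\<^sup>2"] by (simp add: v_0 v_\<phi>)
  have "(8 * (\<Sum>S\<in>pairs_mod p. (y S)\<^sup>2))\<^sup>2 \<le> (\<Sum>P\<in>X. (\<Sum>Q\<in>X. T P Q * v Q)\<^sup>2)\<^sup>2"
    using lower by (intro power_mono) (auto intro: sum_nonneg)
  also have "\<dots> \<le> 4 * 10^7 * real p ^ 5 * (2 * (\<Sum>S\<in>pairs_mod p. (x S)\<^sup>2))\<^sup>2"
    using T_bound[OF sym] unfolding upper .
  finally have sq: "(\<Sum>S\<in>pairs_mod p. (y S)\<^sup>2)\<^sup>2 \<le> 2500000 * real p ^ 5 * (\<Sum>S\<in>pairs_mod p. (x S)\<^sup>2)\<^sup>2"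
    by (simp add: power_mult_distrib)
  have L4: "L2_set z (pairs_mod p) ^ 4 = (\<Sum>S\<in>pairs_mod p. (z S)\<^sup>2)\<^sup>2" for z
  proof -
    have "L2_set z (pairs_mod p) ^ 4 = ((L2_set z (pairs_mod p))\<^sup>2)\<^sup>2" by (simp flip: power_mult)
    then show ?thesis by (simp add: L2_set_def sum_nonneg)
  qed
  have "L2_set y (pairs_mod p) ^ 4 \<le> 2500000 * real p ^ 5 * L2_set x (pairs_mod p) ^ 4"
    using sq by (simp add: L4)
  \<comment> \<open>2500000 is 4 * 10^7 * 2^2 / 8^2, and 40^4 = 2560000 lies just above it.\<close>
  also have "\<dots> \<le> 40 ^ 4 * real p ^ 5 * L2_set x (pairs_mod p) ^ 4"
    by (intro mult_right_mono) auto
  also have "\<dots> = (40 * real p powr (5 / 4) * L2_set x (pairs_mod p)) ^ 4"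
  proof -
    have "(real p powr (5 / 4)) ^ 4 = real p powr (real 4 * (5 / 4))"
      using p_ge by (subst powr_power) auto
    also have "\<dots> = real p ^ 5" using p_ge powr_realpow[of "real p" 5] by simp
    finally show ?thesis by (simp add: power_mult_distrib)
  qed
  finally show ?thesis
    by (rule power_le_imp_le_base[of _ 3, simplified]) simp
qed

lemma T441_opnorm_bound: "\<bar>matrix_opnorm (pairs_mod p) (T441 p)\<bar> \<le> 40 * real p powr (5 / 4)"
proof -
  let ?q = "\<lambda>x. L2_set (\<lambda>i. \<Sum>j\<in>pairs_mod p. T441 p i j * x j) (pairs_mod p) / L2_set x (pairs_mod p)"
  have le: "?q x \<le> 40 * real p powr (5 / 4)" for x
    using T441_bound[of x] by (cases "L2_set x (pairs_mod p) = 0")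
      (simp_all add: divide_le_eq order_less_le)
  then have "matrix_opnorm (pairs_mod p) (T441 p) \<le> 40 * real p powr (5 / 4)"
    unfolding matrix_opnorm_def by (intro cSUP_least) auto
  \<comment> \<open>The absolute value calls for a lower bound of the supremum; the quotient at the
    zero vector is nonnegative and supplies it.\<close>
  moreover have "?q (\<lambda>_. 0) \<le> matrix_opnorm (pairs_mod p) (T441 p)"
    unfolding matrix_opnorm_def using le by (intro cSUP_upper bdd_aboveI2) auto
  then have "0 \<le> matrix_opnorm (pairs_mod p) (T441 p)"
    by (rule order_trans[rotated]) (intro divide_nonneg_nonneg L2_set_nonneg)
  ultimately show ?thesis by simp
qed

end

theorem theorem3p33:
  shows "(\<lambda>p::nat. matrix_opnorm (pairs_mod p) (T441 p))
    \<in> O[inf at_top (principal {p. prime p \<and> [p = 1] (mod 4)})](\<lambda>p. real p powr (5/4))"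
proof (rule bigoI[of _ 40])
  have "norm (matrix_opnorm (pairs_mod p) (T441 p)) \<le> 40 * norm (real p powr (5/4))"
    if "prime p" "[p = 1] (mod 4)" for p :: nat
  proof -
    interpret paley_prime p
      by standard (use that in \<open>auto simp: cong_def\<close>)
    show ?thesis using T441_opnorm_bound by simp
  qed
  then show "\<forall>\<^sub>F p in inf at_top (principal {p. prime p \<and> [p = 1] (mod 4)}).
      norm (matrix_opnorm (pairs_mod p) (T441 p)) \<le> 40 * norm (real p powr (5/4))"
    unfolding eventually_inf_principal by (intro always_eventually) auto
qed

end
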